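(* Let $n\ge 1$, let $\Omega$ be a bounded subset of $\mathbb{R}^n$ and let $p>\frac n2$. Then $M^{p}(\Omega)\cap B\mathcal{M}$ is continuously embedded in $H^{-1}(\mathbb{R}^n)$; that is, every $\mu\in M^p(\Omega)\cap B\mathcal{M}$ belongs to $H^{-1}(\mathbb{R}^n)$ and there is a constant $C$, independent of $\mu$, such that $\|\mu\|_{H^{-1}(\mathbb{R}^n)}\le C\|\mu\|_{M^p}$ for all $\mu\in M^p(\Omega)\cap B\mathcal{M}$.
   Context: $B(x,R)$ denotes the ball in $\mathbb{R}^n$ with center $x$ and radius $R$; $|\mu|$ denotes the total variation of a signed Radon measure $\mu$. The space $M^p(\mathbb{R}^n)$ consists of the (signed) Radon measures $\mu$ on $\mathbb{R}^n$ with $$\|\mu\|_{M^p}:=\sup_{R>0}\Big[R^{-n\left(1-\frac1p\right)}\sup_{x\in\mathbb{R}^n}|\mu|(B(x,R))\Big]<\infty .$$ $M^p(\Omega)$ is the subspace of $M^p(\mathbb{R}^n)$ consisting of the measures supported in $\Omega$. $B\mathcal{M}$ is the space of bounded Radon measures (finite total variation) on $\mathbb{R}^n$. The space $M^p(\Omega)\cap B\mathcal{M}$ is equipped with the norm $\|\cdot\|_{M^p}$. A tempered distribution $f$ on $\mathbb{R}^n$ belongs to $H^{-1}(\mathbb{R}^n)$ if its Fourier transform $\hat f$ is a (locally integrable) function and $\|f\|_{H^{-1}(\mathbb{R}^n)}^2:=\int_{\mathbb{R}^n}(1+|\xi|^2)^{-1}|\hat f(\xi)|^2\,d\xi<\infty$.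 A bounded Radon measure is identified with the tempered distribution it defines. *)

theory Defs
  imports "HOL-Analysis.Analysis"
begin

section \<open>Signed Radon measures and Morrey spaces\<close>

text \<open>
  The space \<open>\<real>\<^sup>n\<close> is a Euclidean space \<open>'a\<close> with \<open>n = DIM('a)\<close> (which is always positive).

  A signed Radon measure may have infinite positive and negative part, so it has a real value only
  on bounded Borel sets. It is therefore a function on sets that is countably additive
  on the bounded Borel sets; its values on all other sets are irrelevant and never used. On
  \<open>\<real>\<^sup>n\<close> the regularity of such a set function is automatic.
\<close>

definition bounded_borel :: "'a::euclidean_space set set" where
  "bounded_borel = {A \<in> sets borel. bounded A}"

definition signed_radon :: "('a::euclidean_space set \<Rightarrow> real) \<Rightarrow> bool" where
  "signed_radon \<mu> \<longleftrightarrow>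
     (\<forall>A::nat \<Rightarrow> 'a set. range A \<subseteq> bounded_borel \<longrightarrow> disjoint_family A \<longrightarrow> bounded (\<Union>i. A i) \<longrightarrow>
        (\<lambda>i. \<mu> (A i)) sums \<mu> (\<Union>i. A i))"

definition total_var :: "('a::euclidean_space set \<Rightarrow> real) \<Rightarrow> 'a set \<Rightarrow> ennreal" where
  "total_var \<mu> A =
     (SUP P \<in> {P. finite P \<and> disjoint P \<and> P \<subseteq> bounded_borel \<and> \<Union>P \<subseteq> A}. \<Sum>B\<in>P. ennreal \<bar>\<mu> B\<bar>)"

definition bounded_radon :: "('a::euclidean_space set \<Rightarrow> real) set" where
  "bounded_radon = {\<mu>. signed_radon \<mu> \<and> total_var \<mu> UNIV < \<infinity>}"

text \<open>The exponent \<open>p\<close> is an extended real; for \<open>p = \<infinity>\<close> one has \<open>1 / p = 0\<close>.\<close>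

definition morrey_norm :: "ereal \<Rightarrow> ('a::euclidean_space set \<Rightarrow> real) \<Rightarrow> ennreal" where
  "morrey_norm p \<mu> =
     (SUP R \<in> {0<..}. ennreal (R powr (- (real DIM('a) * (1 - real_of_ereal (1 / p))))) *
        (SUP x. total_var \<mu> (ball x R)))"

definition morrey :: "ereal \<Rightarrow> ('a::euclidean_space set \<Rightarrow> real) set" where
  "morrey p = {\<mu>. signed_radon \<mu> \<and> morrey_norm p \<mu> < \<infinity>}"

text \<open>
  \<open>\<Omega>\<close> need not be a Borel set, hence the Borel set \<open>N\<close>. If the closed support of \<open>\<mu>\<close> is
  contained in \<open>\<Omega>\<close>, one can take for \<open>N\<close> the complement of the support.
\<close>

definition supported_in :: "('a::euclidean_space set \<Rightarrow> real) \<Rightarrow> 'a set \<Rightarrow> bool" where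
  "supported_in \<mu> \<Omega> \<longleftrightarrow> (\<exists>N \<in> sets borel. - \<Omega> \<subseteq> N \<and> total_var \<mu> N = 0)"

definition morrey_on :: "ereal \<Rightarrow> 'a::euclidean_space set \<Rightarrow> ('a set \<Rightarrow> real) set" where
  "morrey_on p \<Omega> = {\<mu> \<in> morrey p. supported_in \<mu> \<Omega>}"


section \<open>Integration against a signed Radon measure\<close>

definition pos_var :: "('a::euclidean_space set \<Rightarrow> real) \<Rightarrow> 'a set \<Rightarrow> ennreal" where
  "pos_var \<mu> A = (SUP B \<in> {B \<in> bounded_borel. B \<subseteq> A}. ennreal (\<mu> B))"

definition pos_part :: "('a::euclidean_space set \<Rightarrow> real) \<Rightarrow> 'a measure" where
  "pos_part \<mu> = measure_of UNIV (sets borel) (pos_var \<mu>)"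

definition neg_part :: "('a::euclidean_space set \<Rightarrow> real) \<Rightarrow> 'a measure" where
  "neg_part \<mu> = pos_part (\<lambda>A. - \<mu> A)"

definition signed_integral ::
    "('a::euclidean_space set \<Rightarrow> real) \<Rightarrow> ('a \<Rightarrow> complex) \<Rightarrow> complex" where
  "signed_integral \<mu> f = integral\<^sup>L (pos_part \<mu>) f - integral\<^sup>L (neg_part \<mu>) f"

lemma space_pos_part [simp]: "space (pos_part \<mu>) = UNIV"
  by (simp add: pos_part_def space_measure_of_conv)

lemma sets_pos_part [simp]: "sets (pos_part \<mu>) = sets borel"
  by (simp add: pos_part_def sets_measure_of_conv sets.sigma_sets_eq[of borel, simplified])

lemma signed_radon_empty:
  assumes "signed_radon \<mu>" shows "\<mu> {} = 0"
proof -
  have "(\<lambda>i::nat. \<mu> {}) sums \<mu> (\<Union>i::nat. {})"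
    using assms[unfolded signed_radon_def, rule_format, of "\<lambda>_. {}"]
    by (auto simp: bounded_borel_def disjoint_family_on_def)
  then have "summable (\<lambda>i::nat. \<mu> {})" by (rule sums_summable)
  then show ?thesis by (simp add: summable_const_iff)
qed

lemma signed_radon_finite_UN:
  fixes B :: "nat \<Rightarrow> 'a::euclidean_space set"
  assumes \<mu>: "signed_radon \<mu>" and B: "\<And>i. B i \<in> bounded_borel" and d: "disjoint_family B"
  shows "\<mu> (\<Union>i<n. B i) = (\<Sum>i<n. \<mu> (B i))"
proof -
  let ?A = "\<lambda>i. if i < n then B i else {}"
  have U: "(\<Union>i. ?A i) = (\<Union>i<n. B i)" by (auto split: if_splits)
  have "(\<lambda>i. \<mu> (?A i)) sums \<mu> (\<Union>i. ?A i)"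
    using d B by (intro \<mu>[unfolded signed_radon_def, rule_format])
      (auto simp: U bounded_borel_def disjoint_family_on_def)
  moreover have "(\<lambda>i. \<mu> (?A i)) sums (\<Sum>i<n. \<mu> (?A i))"
    by (rule sums_finite) (auto simp: signed_radon_empty[OF \<mu>])
  ultimately show ?thesis unfolding U using sums_unique2 by fastforce
qed

text \<open>The default value of \<^const>\<open>measure_of\<close> for set functions that are not measures plays no role:\<close>

lemma emeasure_pos_part:
  assumes "signed_radon \<mu>" "A \<in> sets borel"
  shows "emeasure (pos_part \<mu>) A = pos_var \<mu> A"
proof (rule emeasure_measure_of[OF pos_part_def])
  show "positive (sets (pos_part \<mu>)) (pos_var \<mu>)"
    using signed_radon_empty[OF assms(1)]
    by (auto simp: positive_def pos_var_def bounded_borel_def Collect_conv_if cong: conj_cong)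
  show "countably_additive (sets (pos_part \<mu>)) (pos_var \<mu>)"
  proof (rule countably_additiveI)
    fix A :: "nat \<Rightarrow> 'a set"
    assume A: "range A \<subseteq> sets (pos_part \<mu>)" and d: "disjoint_family A"
    show "(\<Sum>i. pos_var \<mu> (A i)) = pos_var \<mu> (\<Union>i. A i)"
    proof (rule antisym)
      show "pos_var \<mu> (\<Union>i. A i) \<le> (\<Sum>i. pos_var \<mu> (A i))"
        unfolding pos_var_def[of \<mu> "\<Union>i. A i"]
      proof (rule SUP_least, clarify)
        fix B assume B: "B \<in> bounded_borel" "B \<subseteq> (\<Union>i. A i)"
        have BA: "B \<inter> A i \<in> bounded_borel" for i
          using A B by (auto simp: bounded_borel_def intro: bounded_subset)
        have s: "(\<lambda>i. \<mu> (B \<inter> A i)) sums \<mu> (\<Union>i. B \<inter> A i)"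
          using d BA B by (intro assms(1)[unfolded signed_radon_def, rule_format])
            (auto simp: bounded_borel_def disjoint_family_on_def intro: bounded_subset[of B])
        have "(\<Union>i. B \<inter> A i) = B" using B by auto
        then have l: "(\<lambda>n. ennreal (\<Sum>i<n. \<mu> (B \<inter> A i))) \<longlonglongrightarrow> ennreal (\<mu> B)"
          using s by (auto simp: sums_def intro: tendsto_ennrealI)
        have le: "ennreal (\<Sum>i<n. \<mu> (B \<inter> A i)) \<le> (\<Sum>i. pos_var \<mu> (A i))" for n
        proof -
          have "ennreal (\<Sum>i<n. \<mu> (B \<inter> A i)) \<le> ennreal (\<Sum>i<n. max 0 (\<mu> (B \<inter> A i)))"
            by (intro ennreal_leI sum_mono) auto
          also have "\<dots> = (\<Sum>i<n. ennreal (\<mu> (B \<inter> A i)))"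
            by (simp add: sum_ennreal[symmetric] ennreal_max_0 del: sum_ennreal)
          also have "\<dots> \<le> (\<Sum>i<n. pos_var \<mu> (A i))"
            unfolding pos_var_def using BA by (intro sum_mono SUP_upper) auto
          also have "\<dots> \<le> (\<Sum>i. pos_var \<mu> (A i))" by (rule sum_le_suminf) auto
          finally show ?thesis .
        qed
        show "ennreal (\<mu> B) \<le> (\<Sum>i. pos_var \<mu> (A i))"
          by (rule LIMSEQ_le_const2[OF l]) (use le in auto)
      qed
      show "(\<Sum>i. pos_var \<mu> (A i)) \<le> pos_var \<mu> (\<Union>i. A i)"
      proof (rule suminf_le_const)
        fix n
        have ne: "{B \<in> bounded_borel. B \<subseteq> A i} \<noteq> {}" for i
          by (auto simp: bounded_borel_def intro!: exI[of _ "{}"])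
        show "(\<Sum>i<n. pos_var \<mu> (A i)) \<le> pos_var \<mu> (\<Union>i. A i)"
        proof (rule ennreal_le_epsilon)
          fix e :: real assume e: "0 < e" and fin: "pos_var \<mu> (\<Union>i. A i) < top"
          have fi: "pos_var \<mu> (A i) < top" for i
          proof -
            have "pos_var \<mu> (A i) \<le> pos_var \<mu> (\<Union>i. A i)"
              unfolding pos_var_def by (intro SUP_subset_mono) auto
            then show ?thesis using fin by auto
          qed
          let ?d = "e / real (Suc n)"
          have d0: "0 < ?d" using e by simp
          have "\<exists>B. B \<in> bounded_borel \<and> B \<subseteq> A i \<and> 0 \<le> \<mu> B \<and> pos_var \<mu> (A i) \<le> ennreal (\<mu> B) + ennreal ?d" for i
          proof (cases "pos_var \<mu> (A i) \<le> ennreal ?d")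
            case True
            then show ?thesis using signed_radon_empty[OF assms(1)]
              by (intro exI[of _ "{}"]) (auto simp: bounded_borel_def)
          next
            case False
            then have gt: "ennreal ?d < pos_var \<mu> (A i)" by simp
            then have "pos_var \<mu> (A i) - ennreal ?d < pos_var \<mu> (A i)"
              using fi[of i] d0 le_less_trans[OF zero_le gt] by (intro ennreal_between) auto
            then obtain B where B: "B \<in> bounded_borel" "B \<subseteq> A i" "pos_var \<mu> (A i) - ennreal ?d < ennreal (\<mu> B)"
              unfolding pos_var_def[of \<mu> "A i"] less_SUP_iff by auto
            have "0 < ennreal (\<mu> B)" using B(3) by (metis gr_zeroI not_less_zero)
            then have "0 \<le> \<mu> B" by (simp add: ennreal_less_zero_iff)
            moreover have "pos_var \<mu> (A i) \<le> ennreal (\<mu> B) + ennreal ?d"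
              using B(3) by (metis add.commute ennreal_minus_le_iff less_imp_le)
            ultimately show ?thesis using B by auto
          qed
          then obtain B where B: "\<And>i. B i \<in> bounded_borel" "\<And>i. B i \<subseteq> A i" "\<And>i. 0 \<le> \<mu> (B i)"
            "\<And>i. pos_var \<mu> (A i) \<le> ennreal (\<mu> (B i)) + ennreal ?d" by metis
          have dB: "disjoint_family B" using d B(2) unfolding disjoint_family_on_def by blast
          have UB: "ennreal (\<mu> (\<Union>i<n. B i)) \<le> pos_var \<mu> (\<Union>i. A i)"
            unfolding pos_var_def
          proof (rule SUP_upper)
            have "(\<Union>i<n. B i) \<in> sets borel" "bounded (\<Union>i<n. B i)"
              using B(1) by (auto simp: bounded_borel_def)
            then show "(\<Union>i<n. B i) \<in> {C \<in> bounded_borel. C \<subseteq> (\<Union>i. A i)}"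
              using B(2) unfolding bounded_borel_def by blast
          qed
          have "(\<Sum>i<n. pos_var \<mu> (A i)) \<le> (\<Sum>i<n. ennreal (\<mu> (B i)) + ennreal ?d)"
            by (rule sum_mono, rule B(4))
          also have "\<dots> = (\<Sum>i<n. ennreal (\<mu> (B i))) + (\<Sum>i<n. ennreal ?d)"
            by (rule sum.distrib)
          also have "(\<Sum>i<n. ennreal (\<mu> (B i))) = ennreal (\<Sum>i<n. \<mu> (B i))"
            by (rule sum_ennreal, rule B(3))
          also have "(\<Sum>i<n. \<mu> (B i)) = \<mu> (\<Union>i<n. B i)"
            by (rule signed_radon_finite_UN[OF assms(1) B(1) dB, symmetric])
          also have "(\<Sum>i<n. ennreal ?d) = ennreal (\<Sum>i<n. ?d)"
            using d0 by (intro sum_ennreal less_imp_le)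
          also have "(\<Sum>i<n. ?d) = real n * ?d"
            by simp
          also have "ennreal (\<mu> (\<Union>i<n. B i)) + ennreal (real n * ?d)
              \<le> pos_var \<mu> (\<Union>i. A i) + ennreal e"
            using e by (intro add_mono UB ennreal_leI) (simp add: divide_simps)
          finally show "(\<Sum>i<n. pos_var \<mu> (A i)) \<le> pos_var \<mu> (\<Union>i. A i) + ennreal e" .
        qed
      qed auto
    qed
  qed
qed (use assms in auto)


section \<open>Schwartz functions and tempered distributions\<close>

text \<open>\<open>partial_deriv [b\<^sub>1, \<dots>, b\<^sub>k] f\<close> is the iterated directional derivative of \<open>f\<close> along \<open>b\<^sub>k, \<dots>, b\<^sub>1\<close>.\<close>

fun partial_deriv ::
    "'a::euclidean_space list \<Rightarrow> ('a \<Rightarrow> complex) \<Rightarrow> 'a \<Rightarrow> complex" where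
  "partial_deriv [] f = f"
| "partial_deriv (b # bs) f = (\<lambda>x. frechet_derivative (partial_deriv bs f) (at x) b)"

definition smooth :: "('a::euclidean_space \<Rightarrow> complex) \<Rightarrow> bool" where
  "smooth f \<longleftrightarrow> (\<forall>bs \<in> lists Basis. \<forall>x. partial_deriv bs f differentiable (at x))"

definition test_function :: "('a::euclidean_space \<Rightarrow> complex) \<Rightarrow> bool" where
  "test_function \<phi> \<longleftrightarrow> smooth \<phi> \<and> compact (closure {x. \<phi> x \<noteq> 0})"

definition schwartz :: "('a::euclidean_space \<Rightarrow> complex) \<Rightarrow> bool" where
  "schwartz \<phi> \<longleftrightarrow> smooth \<phi> \<and>
     (\<forall>k::nat. \<forall>bs \<in> lists Basis. bounded (range (\<lambda>x. (1 + norm x) ^ k *\<^sub>R partial_deriv bs \<phi> x)))"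

definition schwartz_seminorm ::
    "nat \<Rightarrow> 'a::euclidean_space list \<Rightarrow> ('a \<Rightarrow> complex) \<Rightarrow> real" where
  "schwartz_seminorm k bs \<phi> = (SUP x. (1 + norm x) ^ k * cmod (partial_deriv bs \<phi> x))"

text \<open>
  A tempered distribution is a continuous linear functional on the Schwartz space. As that space is
  metrizable, sequential continuity at 0 expresses continuity. Values outside the Schwartz
  space are irrelevant.
\<close>

definition tempered_distribution :: "(('a::euclidean_space \<Rightarrow> complex) \<Rightarrow> complex) \<Rightarrow> bool" where
  "tempered_distribution T \<longleftrightarrow>
     (\<forall>\<phi> \<psi>. schwartz \<phi> \<longrightarrow> schwartz \<psi> \<longrightarrow> T (\<lambda>x. \<phi> x + \<psi> x) = T \<phi> + T \<psi>) \<and>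
     (\<forall>c \<phi>. schwartz \<phi> \<longrightarrow> T (\<lambda>x. c * \<phi> x) = c * T \<phi>) \<and>
     (\<forall>\<phi> :: nat \<Rightarrow> 'a \<Rightarrow> complex. (\<forall>m. schwartz (\<phi> m)) \<longrightarrow>
        (\<forall>k. \<forall>bs \<in> lists Basis. (\<lambda>m. schwartz_seminorm k bs (\<phi> m)) \<longlonglongrightarrow> 0) \<longrightarrow>
        (\<lambda>m. T (\<phi> m)) \<longlonglongrightarrow> 0)"

definition distr_of_measure ::
    "('a::euclidean_space set \<Rightarrow> real) \<Rightarrow> ('a \<Rightarrow> complex) \<Rightarrow> complex" where
  "distr_of_measure \<mu> = (\<lambda>\<phi>. signed_integral \<mu> \<phi>)"

definition fourier :: "('a::euclidean_space \<Rightarrow> complex) \<Rightarrow> 'a \<Rightarrow> complex" where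
  "fourier \<phi> \<xi> = (LINT x|lborel. cis (- (x \<bullet> \<xi>)) * \<phi> x)"

definition fourier_distr ::
    "(('a::euclidean_space \<Rightarrow> complex) \<Rightarrow> complex) \<Rightarrow> ('a \<Rightarrow> complex) \<Rightarrow> complex" where
  "fourier_distr T = (\<lambda>\<phi>. T (fourier \<phi>))"


section \<open>The space $H^{-1}$\<close>

definition locally_integrable :: "('a::euclidean_space \<Rightarrow> complex) \<Rightarrow> bool" where
  "locally_integrable g \<longleftrightarrow> (\<forall>K. compact K \<longrightarrow> set_integrable lborel K g)"

text \<open>
  The test functions are dense in the Schwartz space, so a tempered distribution is given by
  a function as soon as this holds on test functions, for which the integral always exists.
\<close>

definition is_function :: "(('a::euclidean_space \<Rightarrow> complex) \<Rightarrow> complex) \<Rightarrow> ('a \<Rightarrow> complex) \<Rightarrow> bool" where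
  "is_function T g \<longleftrightarrow> locally_integrable g \<and>
     (\<forall>\<phi>. test_function \<phi> \<longrightarrow> T \<phi> = (LINT \<xi>|lborel. g \<xi> * \<phi> \<xi>))"

text \<open>The function representing the Fourier transform is unique up to a null set.\<close>

definition fourier_fun :: "(('a::euclidean_space \<Rightarrow> complex) \<Rightarrow> complex) \<Rightarrow> 'a \<Rightarrow> complex" where
  "fourier_fun T = (SOME g. is_function (fourier_distr T) g)"

definition Hm1_sqnorm :: "(('a::euclidean_space \<Rightarrow> complex) \<Rightarrow> complex) \<Rightarrow> ennreal" where
  "Hm1_sqnorm T = (\<integral>\<^sup>+\<xi>. ennreal ((cmod (fourier_fun T \<xi>))\<^sup>2 / (1 + (norm \<xi>)\<^sup>2)) \<partial>lborel)"

definition Hm1 :: "(('a::euclidean_space \<Rightarrow> complex) \<Rightarrow> complex) set" where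
  "Hm1 = {T. tempered_distribution T \<and> (\<exists>g. is_function (fourier_distr T) g) \<and> Hm1_sqnorm T < \<infinity>}"

definition Hm1_norm :: "(('a::euclidean_space \<Rightarrow> complex) \<Rightarrow> complex) \<Rightarrow> real" where
  "Hm1_norm T = sqrt (enn2real (Hm1_sqnorm T))"

end

theory Submission
  imports Defs "HOL-Probability.Probability" "HOL-Real_Asymp.Real_Asymp"
begin

text \<open>
  Let \<open>\<nu>\<close> be a finite positive measure with \<open>\<nu> (ball x R) \<le> M R\<^sup>l\<close>, where \<open>l = n (1 - 1/p) > n - 2\<close>.
  Writing \<open>1 / (1 + |\<xi>|\<^sup>2)\<close> as the integral of \<open>exp (- s (1 + |\<xi>|\<^sup>2))\<close> over \<open>s > 0\<close> turns the
  \<open>H\<^sup>-\<^sup>1\<close> norm of \<open>\<nu>\<close> into a superposition of Gaussian energies: the integral of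
  \<open>exp (- s |\<xi>|\<^sup>2) |F \<nu> \<xi>|\<^sup>2\<close> is \<open>(pi / s)\<^sup>n\<^sup>/\<^sup>2\<close> times the double integral of
  \<open>exp (- |x - y|\<^sup>2 / (4 s))\<close> against \<open>\<nu> \<times> \<nu>\<close>. By the ball condition the inner integral is
  \<open>O(M s\<^sup>l\<^sup>/\<^sup>2)\<close>, and \<open>exp (- s) s\<^bsup>(l - n) / 2\<^esup>\<close> is integrable on \<open>s > 0\<close> exactly because
  \<open>l > n - 2\<close>. The remaining factor, the total mass of \<open>\<nu>\<close>, is \<open>O(M)\<close> as \<open>\<Omega>\<close> is bounded. A signed
  measure is reduced to its positive and negative parts by \<open>|a - b|\<^sup>2 \<le> 2 |a|\<^sup>2 + 2 |b|\<^sup>2\<close>.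
\<close>

section \<open>Uniqueness of locally integrable representatives\<close>

text \<open>\<open>flat 0\<close> is the classical smooth function vanishing to infinite order at 0.
  Differentiation produces powers of \<open>inverse t\<close>; the index \<open>k\<close> closes the
  family under it, up to linear combinations.\<close>

definition flat :: "nat \<Rightarrow> real \<Rightarrow> real" where
  "flat k t = (if 0 < t then exp (- inverse t) * inverse t ^ k else 0)"

lemma flat_nonneg: "0 \<le> flat k t"
  by (simp add: flat_def)

lemma flat_tendsto_0: "(flat k \<longlongrightarrow> 0) (at_right 0)"
proof -
  have "((\<lambda>t::real. inverse t ^ k / exp (inverse t)) \<longlongrightarrow> 0) (at_right 0)"
    by (rule filterlim_compose[OF tendsto_power_div_exp_0 filterlim_inverse_at_top_right])
  moreover have "eventually (\<lambda>t. inverse t ^ k / exp (inverse t) = flat k t) (at_right 0)"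
    using eventually_at_right_less[of "0::real"]
    by eventually_elim (simp add: flat_def exp_minus field_simps)
  ultimately show ?thesis by (rule Lim_transform_eventually)
qed

text \<open>At \<open>t = 0\<close> the right difference quotient of \<open>flat k\<close> is
  \<open>flat (k + 1)\<close>, which tends to 0 because the exponential beats every power; the left
  one is 0. Elsewhere the function is 0 or follows the product rule.\<close>

lemma flat_has_derivative:
  "(flat k has_real_derivative (flat (k + 2) t - real k * flat (k + 1) t)) (at t)"
proof -
  consider "t > 0" | "t = 0" | "t < 0" by linarith
  then show ?thesis
  proof cases
    case 1
    have "((\<lambda>t. exp (- inverse t) * inverse t ^ k) has_real_derivative
        flat (k + 2) t - real k * flat (k + 1) t) (at t)"
      using 1
      apply (cases k)
       apply (auto intro!: derivative_eq_intros simp: flat_def field_simps power2_eq_square)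
      subgoal for j by (cases j) auto
      done
    then show ?thesis
      by (rule has_field_derivative_transform_within_open[where S = "{0<..}"]) (use 1 in \<open>auto simp: flat_def\<close>)
  next
    case 3
    have "((\<lambda>t. 0) has_real_derivative flat (k + 2) t - real k * flat (k + 1) t) (at t)"
      using 3 by (auto simp: flat_def)
    then show ?thesis
      by (rule has_field_derivative_transform_within_open[where S = "{..<0}"]) (use 3 in \<open>auto simp: flat_def\<close>)
  next
    case 2
    have "((\<lambda>h. flat k h / h) \<longlongrightarrow> 0) (at_right 0)"
    proof (rule Lim_transform_eventually[OF flat_tendsto_0[of "k+1"]])
      show "eventually (\<lambda>t. flat (k + 1) t = flat k t / t) (at_right 0)"
        using eventually_at_right_less[of "0::real"]
        by eventually_elim (simp add: flat_def field_simps)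
    qed
    moreover have "((\<lambda>h. flat k h / h) \<longlongrightarrow> 0) (at_left 0)"
    proof (rule Lim_transform_eventually[OF tendsto_const])
      show "eventually (\<lambda>t. 0 = flat k t / t) (at_left 0)"
        unfolding eventually_at_left_field by (rule exI[of _ "-1"]) (simp add: flat_def)
    qed
    ultimately have "((\<lambda>h. flat k h / h) \<longlongrightarrow> 0) (at 0)"
      by (simp add: filterlim_split_at)
    then show ?thesis by (simp add: 2 DERIV_def flat_def)
  qed
qed

text \<open>
  An algebra of functions that is closed under partial derivatives, so that all its members are smooth.
\<close>

inductive_set flat_algebra :: "('a::euclidean_space \<Rightarrow> complex) set" where
  const: "(\<lambda>x. c) \<in> flat_algebra"
| flat: "(\<lambda>x. of_real (flat k (r * (x \<bullet> b) + s))) \<in> flat_algebra"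
| add: "f \<in> flat_algebra \<Longrightarrow> g \<in> flat_algebra \<Longrightarrow> (\<lambda>x. f x + g x) \<in> flat_algebra"
| mult: "f \<in> flat_algebra \<Longrightarrow> g \<in> flat_algebra \<Longrightarrow> (\<lambda>x. f x * g x) \<in> flat_algebra"

text \<open>The chain rule along the affine map turns a generator into a combination of generators
  with indices \<open>k + 1\<close> and \<open>k + 2\<close>. Asking for membership at each fixed
  direction \<open>v\<close> is what allows iteration.\<close>

lemma flat_algebra_derivative:
  assumes "f \<in> flat_algebra"
  shows "\<exists>D. (\<forall>x. (f has_derivative D x) (at x)) \<and> (\<forall>v. (\<lambda>x. D x v) \<in> flat_algebra)"
  using assms
proof induction
  case (const c)
  show ?case
    by (rule exI[of _ "\<lambda>_ _. 0"]) (auto intro: flat_algebra.const)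
next
  case (flat k r b s)
  let ?d = "\<lambda>t. flat (k + 2) t - real k * flat (k + 1) t"
  let ?D = "\<lambda>x v. complex_of_real (?d (r * (x \<bullet> b) + s) * (r * (v \<bullet> b)))"
  have "((\<lambda>x. complex_of_real (flat k (r * (x \<bullet> b) + s))) has_derivative ?D x) (at x)" for x
  proof -
    have "((\<lambda>x. r * (x \<bullet> b) + s) has_derivative (\<lambda>v. r * (v \<bullet> b))) (at x)"
      by (auto intro!: derivative_eq_intros)
    from has_derivative_compose[OF this, OF flat_has_derivative[of k, unfolded has_field_derivative_def]]
    have "((\<lambda>x. flat k (r * (x \<bullet> b) + s)) has_derivative (\<lambda>v. ?d (r * (x \<bullet> b) + s) * (r * (v \<bullet> b)))) (at x)" .
    then show ?thesis by (rule has_derivative_of_real)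
  qed
  moreover have "(\<lambda>x. ?D x v) \<in> flat_algebra" for v
  proof -
    have eq: "(\<lambda>x. ?D x v) = (\<lambda>x. of_real (r * (v \<bullet> b)) * of_real (flat (k + 2) (r * (x \<bullet> b) + s))
        + of_real (- real k * r * (v \<bullet> b)) * of_real (flat (k + 1) (r * (x \<bullet> b) + s)))"
      by (auto simp: algebra_simps)
    show ?thesis unfolding eq by (intro flat_algebra.intros)
  qed
  ultimately show ?case by (intro exI[of _ ?D]) auto
next
  case (add f g)
  then obtain F G where "\<forall>x. (f has_derivative F x) (at x)" "\<forall>v. (\<lambda>x. F x v) \<in> flat_algebra"
    "\<forall>x. (g has_derivative G x) (at x)" "\<forall>v. (\<lambda>x. G x v) \<in> flat_algebra" by blast
  then show ?case
    by (intro exI[of _ "\<lambda>x v. F x v + G x v"]) (intro conjI allI has_derivative_add flat_algebra.add; simp)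
next
  case (mult f g)
  then obtain F G where "\<forall>x. (f has_derivative F x) (at x)" "\<forall>v. (\<lambda>x. F x v) \<in> flat_algebra"
    "\<forall>x. (g has_derivative G x) (at x)" "\<forall>v. (\<lambda>x. G x v) \<in> flat_algebra" by blast
  then show ?case using mult.hyps
    by (intro exI[of _ "\<lambda>x v. f x * G x v + F x v * g x"])
      (intro conjI allI has_derivative_mult flat_algebra.add flat_algebra.mult; simp)
qed

text \<open>Iterated differentiation never leaves the algebra, and its members are
  differentiable.\<close>

lemma flat_algebra_smooth:
  assumes "f \<in> flat_algebra" shows "smooth f"
proof -
  have "partial_deriv bs f \<in> flat_algebra" for bs
  proof (induction bs)
    case (Cons b bs)
    then obtain D where D: "\<And>x. (partial_deriv bs f has_derivative D x) (at x)"
      "\<And>v. (\<lambda>x. D x v) \<in> flat_algebra" using flat_algebra_derivative by blast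
    have "partial_deriv (b # bs) f = (\<lambda>x. D x b)"
      by (simp add: frechet_derivative_at[OF D(1), symmetric])
    then show ?case using D(2) by simp
  qed (use assms in simp)
  then show ?thesis
    unfolding smooth_def using flat_algebra_derivative differentiableI by blast
qed

lemma flat_algebra_prod:
  assumes "\<And>i. i \<in> I \<Longrightarrow> f i \<in> flat_algebra"
  shows "(\<lambda>x. \<Prod>i\<in>I. f i x) \<in> flat_algebra"
  using assms by (induction I rule: infinite_finite_induct) (auto intro: flat_algebra.intros)

text \<open>
  As \<open>flat 0 (r t)\<close> is the \<open>r\<close>-th root of \<open>flat 0 t\<close>, these test functions converge to the
  indicator function of the box.
\<close>

definition bump :: "'a::euclidean_space \<Rightarrow> 'a \<Rightarrow> nat \<Rightarrow> 'a \<Rightarrow> complex" where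
  "bump a b m x = of_real (\<Prod>i\<in>Basis. flat 0 (real (Suc m) * (x \<bullet> i - a \<bullet> i)) *
      flat 0 (real (Suc m) * (b \<bullet> i - x \<bullet> i)))"

lemma bump_support: "bump a b m x \<noteq> 0 \<longleftrightarrow> x \<in> box a b"
  by (auto simp: bump_def flat_def box_def zero_less_mult_iff not_less)

lemma test_function_bump: "test_function (bump a b m)"
  unfolding test_function_def
proof
  \<comment> \<open>Each factor is put into the generator form
    \<open>r * (x \<bullet> b) + s\<close>, with slopes of both signs.\<close>
  have eq: "bump a b m = (\<lambda>x. \<Prod>i\<in>Basis.
      of_real (flat 0 (real (Suc m) * (x \<bullet> i) + (- real (Suc m) * (a \<bullet> i)))) *
      of_real (flat 0 (- real (Suc m) * (x \<bullet> i) + real (Suc m) * (b \<bullet> i))))"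
    by (simp add: bump_def right_diff_distrib fun_eq_iff flip: of_nat_Suc)
  show "smooth (bump a b m)"
    unfolding eq by (intro flat_algebra_smooth flat_algebra_prod flat_algebra.intros)
  have "bounded {x. bump a b m x \<noteq> 0}"
    by (simp add: bump_support bounded_box)
  then show "compact (closure {x. bump a b m x \<noteq> 0})"
    by simp
qed

lemma bump_norm_le: "cmod (bump a b m x) \<le> indicator (box a b) x"
proof (cases "x \<in> box a b")
  case True
  have "flat 0 t \<le> 1" for t by (simp add: flat_def)
  then have "(\<Prod>i\<in>Basis. flat 0 (real (Suc m) * (x \<bullet> i - a \<bullet> i)) *
      flat 0 (real (Suc m) * (b \<bullet> i - x \<bullet> i))) \<le> 1"
    by (intro prod_le_1 conjI mult_nonneg_nonneg flat_nonneg mult_le_one)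
  moreover have "0 \<le> (\<Prod>i\<in>Basis. flat 0 (real (Suc m) * (x \<bullet> i - a \<bullet> i)) *
      flat 0 (real (Suc m) * (b \<bullet> i - x \<bullet> i)))"
    by (intro prod_nonneg mult_nonneg_nonneg flat_nonneg)
  ultimately show ?thesis using True unfolding bump_def norm_of_real by simp
next
  case False
  then show ?thesis using bump_support[of a b m x] by simp
qed

lemma bump_tendsto: "(\<lambda>m. bump a b m x) \<longlonglongrightarrow> indicator (box a b) x"
proof (cases "x \<in> box a b")
  case True
  have f: "(\<lambda>m. flat 0 (real (Suc m) * t)) \<longlonglongrightarrow> 1" if "t > 0" for t
  proof -
    have "(\<lambda>m. exp (- (inverse (real (Suc m)) * inverse t))) \<longlonglongrightarrow> exp (- (0 * inverse t))"
      by (intro tendsto_intros LIMSEQ_inverse_real_of_nat)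
    then show ?thesis using that by (simp add: flat_def del: of_nat_Suc)
  qed
  have "(\<lambda>m. \<Prod>i\<in>Basis. flat 0 (real (Suc m) * (x \<bullet> i - a \<bullet> i)) *
      flat 0 (real (Suc m) * (b \<bullet> i - x \<bullet> i))) \<longlonglongrightarrow> (\<Prod>i\<in>(Basis::'a set). 1 * 1)"
    using True by (intro tendsto_prod tendsto_mult f) (auto simp: box_def)
  then have "(\<lambda>m. complex_of_real (\<Prod>i\<in>Basis. flat 0 (real (Suc m) * (x \<bullet> i - a \<bullet> i)) *
      flat 0 (real (Suc m) * (b \<bullet> i - x \<bullet> i)))) \<longlonglongrightarrow> complex_of_real (\<Prod>i\<in>(Basis::'a set). 1 * 1)"
    by (rule tendsto_of_real)
  then show ?thesis using True unfolding bump_def by simp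
next
  case False
  then show ?thesis using bump_support[of a b _ x] by simp
qed

section \<open>Functions that integrate to zero against all test functions\<close>

lemma smooth_continuous: "smooth f \<Longrightarrow> continuous_on A f"
proof (rule continuous_at_imp_continuous_on, rule ballI)
  fix x assume "smooth f"
  then have "partial_deriv [] f differentiable (at x)"
    unfolding smooth_def by (metis lists.Nil)
  then show "isCont f x" by (simp add: differentiable_imp_continuous_within)
qed

lemma integrable_locally_integrable_box:
  fixes g :: "'a::euclidean_space \<Rightarrow> complex"
  assumes "locally_integrable g"
  shows "set_integrable lborel (box a b) g"
proof (rule set_integrable_subset)
  show "set_integrable lborel (cbox a b) g"
    using assms by (auto simp: locally_integrable_def)
qed (auto simp: box_subset_cbox)

text \<open>Testing against the bumps and passing to the limit by dominated convergence, with
  \<open>|g|\<close> on the box as majorant, replaces them by the indicator of the box.\<close>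

lemma box_integral_eq_0:
  fixes g :: "'a::euclidean_space \<Rightarrow> complex"
  assumes g: "locally_integrable g"
    and test: "\<And>\<phi>. test_function \<phi> \<Longrightarrow> (LINT x|lborel. g x * \<phi> x) = 0"
  shows "(LINT x:box a b|lborel. g x) = 0"
proof -
  let ?I = "\<lambda>x. indicator (box a b) x *\<^sub>R g x"
  have i: "integrable lborel ?I"
    using integrable_locally_integrable_box[OF g] by (simp add: set_integrable_def)
  \<comment> \<open>A bump vanishes off the box, so \<open>g\<close> may be cut off there, which
    makes it integrable.\<close>
  have eq: "g x * bump a b m x = ?I x * bump a b m x" for x m
    using bump_support[of a b m x] by (auto simp: indicator_def)
  have [measurable]: "bump a b m \<in> borel_measurable borel" for m
    using test_function_bump smooth_continuous unfolding test_function_def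
    by (intro borel_measurable_continuous_onI) blast
  have "(\<lambda>m. LINT x|lborel. ?I x * bump a b m x) \<longlonglongrightarrow> (LINT x|lborel. ?I x)"
  proof (rule integral_dominated_convergence[where w = "\<lambda>x. cmod (?I x)"])
    show "AE x in lborel. (\<lambda>m. ?I x * bump a b m x) \<longlonglongrightarrow> ?I x"
    proof (rule AE_I2)
      fix x
      have "(\<lambda>m. ?I x * bump a b m x) \<longlonglongrightarrow> ?I x * indicator (box a b) x"
        by (intro tendsto_intros bump_tendsto)
      then show "(\<lambda>m. ?I x * bump a b m x) \<longlonglongrightarrow> ?I x" by (cases "x \<in> box a b") simp_all
    qed
    show "AE x in lborel. cmod (?I x * bump a b m x) \<le> cmod (?I x)" for m
      using order_trans[OF bump_norm_le[of a b m] indicator_le_1]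
      by (intro AE_I2) (simp add: norm_mult mult_right_le_one_le mult_left_mono)
    show "(\<lambda>x. ?I x * bump a b m x) \<in> borel_measurable lborel" for m
      using borel_measurable_integrable[OF i] by (intro borel_measurable_times) auto
    show "?I \<in> borel_measurable lborel" "integrable lborel (\<lambda>x. cmod (?I x))"
      using i by (rule borel_measurable_integrable, rule integrable_norm)
  qed
  moreover have "(LINT x|lborel. ?I x * bump a b m x) = 0" for m
    using test[OF test_function_bump, of a b m] by (simp only: eq)
  ultimately have "(\<lambda>m::nat. 0) \<longlonglongrightarrow> (LINT x|lborel. ?I x)"
    by simp
  from LIMSEQ_unique[OF tendsto_const this] show ?thesis
    by (simp add: set_lebesgue_integral_def)
qed

text \<open>An integrable function is 0 almost everywhere once its integral over every Borel set is
  0. Boxes are stable under intersection and generate the Borel sets, so Dynkin induction carries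
  the vanishing from boxes to all of them.\<close>

lemma locally_integrable_AE_0:
  fixes g :: "'a::euclidean_space \<Rightarrow> complex"
  assumes g: "locally_integrable g"
    and test: "\<And>\<phi>. test_function \<phi> \<Longrightarrow> (LINT x|lborel. g x * \<phi> x) = 0"
  shows "AE x in lborel. g x = 0"
proof -
  \<comment> \<open>As \<open>g\<close> is only locally integrable, its cutoffs to single boxes are
    treated one at a time.\<close>
  have "AE x in lborel. indicator (box a b) x *\<^sub>R g x = 0" for a b :: 'a
  proof (rule sigma_finite_measure.density_zero[OF sigma_finite_lborel])
    let ?I = "\<lambda>x. indicator (box a b) x *\<^sub>R g x"
    show i: "integrable lborel ?I"
      using integrable_locally_integrable_box[OF g] by (simp add: set_integrable_def)
    have whole: "(LINT x|lborel. ?I x) = 0"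
      using box_integral_eq_0[OF g test] by (simp add: set_lebesgue_integral_def)
    have si: "set_integrable lborel A ?I" if "A \<in> sets lborel" for A
      using integrable_mult_indicator[OF that i] by (simp add: set_integrable_def)
    fix A :: "'a set" assume "A \<in> sets lborel"
    then have A: "A \<in> sigma_sets UNIV (range (\<lambda>(a, b). box a b))"
      by (simp add: borel_eq_box)
    have boxes: "Int_stable (range (\<lambda>(a, b). box a b :: 'a set))"
      unfolding Int_stable_def by (auto simp: box_Int_box)
    have subset: "range (\<lambda>(a, b). box a b :: 'a set) \<subseteq> Pow UNIV"
      by simp
    have sig: "sigma_sets UNIV (range (\<lambda>(a, b). box a b :: 'a set)) = sets lborel"
      by (simp add: borel_eq_box)
    show "(LINT x:A|lborel. ?I x) = 0"
      using boxes subset A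
    proof (induction rule: sigma_sets_induct_disjoint)
      case (basic A)
      then obtain c d where A: "A = box c d" by auto
      \<comment> \<open>The cutoff box and the testing box meet in a box, so the base case is again
        the vanishing over boxes.\<close>
      obtain e f where "box c d \<inter> box a b = box e f"
        using box_Int_box[of c d a b] by (rule that)
      then have "indicator A x *\<^sub>R ?I x = indicator (box e f) x *\<^sub>R g x" for x
        by (simp only: A scaleR_scaleR indicator_inter_arith[symmetric])
      then show ?case
        using box_integral_eq_0[OF g test, of e f] by (simp only: set_lebesgue_integral_def)
    next
      case empty
      show ?case by (simp add: set_lebesgue_integral_def)
    next
      case (compl A)
      then have A: "A \<in> sets lborel" using sig by simp
      have "(LINT x|lborel. ?I x) = (LINT x:A \<union> (UNIV - A)|lborel. ?I x)"
        by (simp add: set_lebesgue_integral_def)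
      also have "\<dots> = (LINT x:A|lborel. ?I x) + (LINT x:UNIV - A|lborel. ?I x)"
        using A by (intro set_integral_Un si) auto
      finally show ?case using whole compl by simp
    next
      case (union A)
      then have A: "\<And>i. A i \<in> sets lborel" using sig by auto
      have "(LINT x:(\<Union>i. A i)|lborel. ?I x) = (\<Sum>i. LINT x:A i|lborel. ?I x)"
      proof (rule lebesgue_integral_countable_add)
        show "set_integrable lborel (\<Union>i. A i) ?I" using A by (intro si) auto
      qed (use A union in \<open>auto simp: disjoint_family_on_def\<close>)
      then show ?case using union by simp
    qed
  qed
  \<comment> \<open>Countably many of these boxes cover the space, so the exceptional null sets can
    be united.\<close>
  then have "\<And>n. AE x in lborel. indicator (box (- (real n *\<^sub>R One)) (real n *\<^sub>R One)) x *\<^sub>R g x = 0" .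
  then have "AE x in lborel. \<forall>n::nat. indicator (box (- (real n *\<^sub>R One)) (real n *\<^sub>R One)) x *\<^sub>R g x = 0"
    by (simp only: AE_all_countable) simp
  then show ?thesis
  proof eventually_elim
    case (elim x)
    obtain n :: nat where "x \<in> box (- (real n *\<^sub>R One)) (real n *\<^sub>R One)"
    proof -
      have "x \<in> (\<Union>n::nat. box (- (real n *\<^sub>R One)) (real n *\<^sub>R One))"
        unfolding UN_box_eq_UNIV by (rule UNIV_I)
      then show ?thesis by (rule UN_E) (rule that)
    qed
    with elim[rule_format, of n] show ?case by simp
  qed
qed

section \<open>Integration against test functions and uniqueness\<close>

lemma test_function_bounded_integrable:
  assumes "test_function \<phi>"
  obtains K B where "compact K" "\<And>x. \<phi> x \<noteq> 0 \<Longrightarrow> x \<in> K" "\<And>x. cmod (\<phi> x) \<le> B"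
    "\<phi> \<in> borel_measurable borel" "integrable lborel \<phi>"
proof -
  let ?K = "closure {x. \<phi> x \<noteq> 0}"
  have K: "compact ?K" and c: "continuous_on A \<phi>" for A
    using assms smooth_continuous by (auto simp: test_function_def)
  have s: "\<phi> x \<noteq> 0 \<Longrightarrow> x \<in> ?K" for x
    using closure_subset by fastforce
  have "bounded (\<phi> ` ?K)"
    by (intro compact_imp_bounded compact_continuous_image c K)
  then obtain B where "\<And>x. x \<in> ?K \<Longrightarrow> cmod (\<phi> x) \<le> B"
    by (auto simp: bounded_iff)
  \<comment> \<open>\<open>max 0\<close> covers the points outside the support, about which
    \<open>B\<close> says nothing.\<close>
  then have "cmod (\<phi> x) \<le> max 0 B" for x
    using s[of x] by (cases "\<phi> x = 0") (auto simp: le_max_iff_disj)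
  moreover have "(\<lambda>x. indicator ?K x *\<^sub>R \<phi> x) = \<phi>"
    using s by (auto simp: fun_eq_iff indicator_def)
  then have "integrable lborel \<phi>"
    using borel_integrable_compact[OF K c] by simp
  ultimately show ?thesis
    using borel_measurable_continuous_onI[OF c] by (intro that[OF K s])
qed

lemma locally_integrable_mult_test_function:
  assumes g: "locally_integrable g" and "test_function \<phi>"
  shows "integrable lborel (\<lambda>x. g x * \<phi> x)"
proof -
  obtain K B where K: "compact K" "\<And>x. \<phi> x \<noteq> 0 \<Longrightarrow> x \<in> K" "\<And>x. cmod (\<phi> x) \<le> B"
    and [measurable]: "\<phi> \<in> borel_measurable borel"
    by (rule test_function_bounded_integrable[OF assms(2)]) rule
  have gK: "integrable lborel (\<lambda>x. indicator K x *\<^sub>R g x)"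
    using g K(1) by (auto simp: locally_integrable_def set_integrable_def)
  have eq: "(\<lambda>x. g x * \<phi> x) = (\<lambda>x. (indicator K x *\<^sub>R g x) * \<phi> x)"
    using K(2) by (auto simp: fun_eq_iff indicator_def)
  have B: "0 \<le> B" by (rule order_trans[OF norm_ge_zero K(3)[of 0]])
  show ?thesis
  proof (rule Bochner_Integration.integrable_bound)
    show "integrable lborel (\<lambda>x. B *\<^sub>R (indicator K x *\<^sub>R g x))"
      using gK by (rule integrable_scaleR_right)
    show "(\<lambda>x. g x * \<phi> x) \<in> borel_measurable lborel"
      unfolding eq using borel_measurable_integrable[OF gK] by (intro borel_measurable_times) auto
    show "AE x in lborel. norm (g x * \<phi> x) \<le> norm (B *\<^sub>R (indicator K x *\<^sub>R g x))"
    proof (rule AE_I2)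
      fix x
      show "norm (g x * \<phi> x) \<le> norm (B *\<^sub>R (indicator K x *\<^sub>R g x))"
      proof (cases "x \<in> K")
        case True
        then show ?thesis
          using mult_right_mono[OF K(3)[of x], of "cmod (g x)"] B by (simp add: norm_mult mult.commute)
      next
        case False
        then have "\<phi> x = 0" using K(2) by blast
        then show ?thesis by simp
      qed
    qed
  qed
qed

text \<open>The difference of two representatives integrates to 0 against every test function. This
  makes the arbitrary choice in \<open>fourier_fun\<close> harmless.\<close>

lemma is_function_unique:
  assumes f: "is_function T f" and g: "is_function T g"
  shows "AE x in lborel. f x = g x"
proof -
  have "AE x in lborel. f x - g x = 0"
  proof (rule locally_integrable_AE_0)
    show "locally_integrable (\<lambda>x. f x - g x)"
      using f g by (auto simp: is_function_def locally_integrable_def)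
    fix \<phi> :: "'a \<Rightarrow> complex" assume \<phi>: "test_function \<phi>"
    then have "(LINT x|lborel. (f x - g x) * \<phi> x) = (LINT x|lborel. f x * \<phi> x) - (LINT x|lborel. g x * \<phi> x)"
      unfolding left_diff_distrib using f g
      by (intro Bochner_Integration.integral_diff locally_integrable_mult_test_function) (auto simp: is_function_def)
    then show "(LINT x|lborel. (f x - g x) * \<phi> x) = 0"
      using f g \<phi> by (simp add: is_function_def)
  qed
  then show ?thesis by simp
qed

section \<open>Gaussian energy of a positive measure\<close>

lemma borel_measurable_cis [measurable]:
  assumes [measurable]: "f \<in> borel_measurable M"
  shows "(\<lambda>x. cis (f x)) \<in> borel_measurable M"
  unfolding cis_conv_exp by measurable

lemma cis_sum: "cis (\<Sum>i\<in>I. f i) = (\<Prod>i\<in>I. cis (f i))"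
  by (induction I rule: infinite_finite_induct) (simp_all flip: cis_mult)

lemma gaussian_integrable_real:
  assumes "0 < s" shows "integrable lborel (\<lambda>t::real. exp (- (s * t\<^sup>2)))"
proof -
  have "integrable lborel (\<lambda>t. std_normal_density (0 + sqrt (2 * s) * t))"
    using assms by (intro lborel_integrable_real_affine) auto
  moreover have "std_normal_density (0 + sqrt (2 * s) * t) = (1 / sqrt (2 * pi)) * exp (- (s * t\<^sup>2))" for t
    using assms by (simp add: std_normal_density_def power_mult_distrib)
  ultimately have "integrable lborel (\<lambda>t. (1 / sqrt (2 * pi)) * exp (- (s * t\<^sup>2)))" by simp
  from integrable_mult_right[OF this, of "sqrt (2 * pi)"] show ?thesis by simp
qed

text \<open>Substituting \<open>u = sqrt (2 * s) * t\<close> turns the integral into the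
  characteristic function of the standard normal distribution.\<close>

lemma gaussian_fourier_real:
  fixes s z :: real
  assumes "0 < s"
  shows "(LINT t|lborel. complex_of_real (exp (- (s * t\<^sup>2))) * cis (- (z * t)))
    = of_real (sqrt (pi / s) * exp (- (z\<^sup>2 / (4 * s))))"
proof -
  \<comment> \<open>Chosen so that \<open>\<tau> * (sqrt (2 * s) * t) = - (z * t)\<close>.\<close>
  define \<tau> where "\<tau> = - z / sqrt (2 * s)"
  define f where "f u = std_normal_density u *\<^sub>R iexp (\<tau> * u)" for u
  have "of_real (exp (- (\<tau>\<^sup>2) / 2)) = char std_normal_distribution \<tau>"
    by (simp add: char_std_normal_distribution)
  also have "\<dots> = (LINT u|lborel. f u)"
    unfolding char_def f_def by (subst integral_density) auto
  also have "\<dots> = \<bar>sqrt (2 * s)\<bar> *\<^sub>R (LINT u|lborel. f (0 + sqrt (2 * s) * u))"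
    using assms by (intro lborel_integral_real_affine) auto
  also have "(\<lambda>u. f (0 + sqrt (2 * s) * u))
      = (\<lambda>t. (1 / sqrt (2 * pi)) *\<^sub>R (complex_of_real (exp (- (s * t\<^sup>2))) * cis (- (z * t))))"
    using assms
    by (simp add: f_def \<tau>_def std_normal_density_def power_mult_distrib cis_conv_exp scaleR_conv_of_real fun_eq_iff)
  finally have eq: "of_real (exp (- (\<tau>\<^sup>2) / 2)) = sqrt (2 * s) *\<^sub>R (1 / sqrt (2 * pi)) *\<^sub>R
      (LINT t|lborel. complex_of_real (exp (- (s * t\<^sup>2))) * cis (- (z * t)))" (is "_ = _ *\<^sub>R _ *\<^sub>R ?I")
    using assms by (simp add: mult.commute)
  \<comment> \<open>\<open>sqrt (pi / s)\<close> inverts the product of the Jacobian and the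
    normalizing factor of the density.\<close>
  have "sqrt (pi / s) * (sqrt (2 * s) * (1 / sqrt (2 * pi))) = 1"
    using assms by (simp add: real_sqrt_mult real_sqrt_divide)
  then have "?I = (sqrt (pi / s) * (sqrt (2 * s) * (1 / sqrt (2 * pi)))) *\<^sub>R ?I"
    by (simp only: scaleR_one)
  also have "\<dots> = sqrt (pi / s) *\<^sub>R (sqrt (2 * s) *\<^sub>R (1 / sqrt (2 * pi)) *\<^sub>R ?I)"
    by (simp only: scaleR_scaleR mult.assoc)
  also have "\<dots> = sqrt (pi / s) *\<^sub>R of_real (exp (- (\<tau>\<^sup>2) / 2))"
    by (simp only: eq)
  also have "- (\<tau>\<^sup>2) / 2 = - (z\<^sup>2 / (4 * s))"
    using assms by (simp add: \<tau>_def power_divide)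
  finally show ?thesis by (simp add: scaleR_conv_of_real)
qed

text \<open>Gaussian and character both split into products over the coordinates, and Lebesgue
  measure is an image of the product measure, so the one-dimensional formula applies
  coordinatewise.\<close>

lemma gaussian_fourier:
  fixes z :: "'a::euclidean_space"
  assumes "0 < s"
  shows "integrable lborel (\<lambda>\<xi>. complex_of_real (exp (- (s * (norm \<xi>)\<^sup>2))) * cis (- (z \<bullet> \<xi>)))" (is ?int)
    and "(LINT \<xi>|lborel. complex_of_real (exp (- (s * (norm \<xi>)\<^sup>2))) * cis (- (z \<bullet> \<xi>)))
      = of_real (sqrt (pi / s) ^ DIM('a) * exp (- ((norm z)\<^sup>2 / (4 * s))))" (is ?eq)
proof -
  interpret product_sigma_finite "\<lambda>b::'a. lborel :: real measure"
    by standard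
  let ?g = "\<lambda>\<xi>::'a. complex_of_real (exp (- (s * (norm \<xi>)\<^sup>2))) * cis (- (z \<bullet> \<xi>))"
  let ?T = "\<lambda>f::'a \<Rightarrow> real. \<Sum>b\<in>Basis. f b *\<^sub>R b"
  let ?h = "\<lambda>b t. complex_of_real (exp (- (s * t\<^sup>2))) * cis (- ((z \<bullet> b) * t))"
  have T: "?T \<in> (\<Pi>\<^sub>M b\<in>Basis. lborel) \<rightarrow>\<^sub>M borel"
    by measurable
  have g: "?g \<in> borel_measurable borel"
    by measurable
  have gT: "?g (?T f) = (\<Prod>b\<in>Basis. ?h b (f b))" for f
  proof -
    have "(norm (?T f))\<^sup>2 = (\<Sum>b\<in>Basis. (f b)\<^sup>2)"
      unfolding power2_norm_eq_inner
      by (subst euclidean_inner) (simp add: inner_sum_left inner_Basis if_distrib power2_eq_square cong: if_cong)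
    moreover have "z \<bullet> ?T f = (\<Sum>b\<in>Basis. (z \<bullet> b) * f b)"
      by (simp add: inner_sum_right mult.commute)
    ultimately show ?thesis
      by (simp add: prod.distrib cis_sum sum_distrib_left exp_sum sum_negf[symmetric] del: sum_negf)
  qed
  have h: "integrable lborel (?h b)" for b
  proof (rule Bochner_Integration.integrable_bound)
    show "integrable lborel (\<lambda>t::real. exp (- (s * t\<^sup>2)))"
      using assms by (rule gaussian_integrable_real)
    show "?h b \<in> borel_measurable lborel"
      by measurable
  qed (simp add: norm_mult)
  have i: "integrable (\<Pi>\<^sub>M b\<in>Basis. lborel) (\<lambda>f. \<Prod>b\<in>Basis. ?h b (f b))"
    by (intro product_integrable_prod h finite_Basis)
  show ?int
    unfolding lborel_eq[where 'a='a] integrable_distr_eq[OF T g] gT using i .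
  have "(LINT \<xi>|lborel. ?g \<xi>) = (LINT f|(\<Pi>\<^sub>M b\<in>Basis. lborel). ?g (?T f))"
    by (subst lborel_eq) (rule integral_distr[OF T g])
  also have "\<dots> = (\<Prod>b\<in>Basis. integral\<^sup>L lborel (?h b))"
    unfolding gT by (intro product_integral_prod h finite_Basis)
  also have "\<dots> = (\<Prod>b\<in>Basis. of_real (sqrt (pi / s) * exp (- ((z \<bullet> b)\<^sup>2 / (4 * s)))))"
    by (simp only: gaussian_fourier_real[OF assms])
  also have "\<dots> = of_real (sqrt (pi / s) ^ DIM('a) * exp (- ((norm z)\<^sup>2 / (4 * s))))"
    unfolding power2_norm_eq_inner
    by (subst (2) euclidean_inner)
      (simp add: prod.distrib exp_sum sum_divide_distrib power2_eq_square sum_negf[symmetric] del: sum_negf)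
  finally show ?eq .
qed

section \<open>The Fourier transform of a finite measure and its Gaussian energy\<close>

definition fourier_measure :: "'a::euclidean_space measure \<Rightarrow> 'a \<Rightarrow> complex" where
  "fourier_measure \<nu> \<xi> = (LINT x|\<nu>. cis (- (x \<bullet> \<xi>)))"

context
  fixes \<nu> :: "'a::euclidean_space measure"
  assumes fin: "finite_measure \<nu>" and sets [measurable_cong, simp]: "sets \<nu> = sets borel"
begin

interpretation finite_measure \<nu> by (rule fin)
interpretation \<kappa>: pair_sigma_finite \<nu> \<nu> ..
interpretation \<kappa>: finite_measure "\<nu> \<Otimes>\<^sub>M \<nu>"
  by (rule finite_measure_pair_measure[OF fin fin])
interpretation \<kappa>l: pair_sigma_finite "\<nu> \<Otimes>\<^sub>M \<nu>" "lborel :: 'a measure" ..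

lemma space_eq_UNIV [simp]: "space \<nu> = UNIV"
  using sets_eq_imp_space_eq[OF sets] by simp

lemma fourier_measure_measurable [measurable]: "fourier_measure \<nu> \<in> borel_measurable borel"
  unfolding fourier_measure_def by measurable

lemma fourier_measure_norm_le: "cmod (fourier_measure \<nu> \<xi>) \<le> measure \<nu> UNIV"
proof -
  have "cmod (fourier_measure \<nu> \<xi>) \<le> (LINT x|\<nu>. cmod (cis (- (x \<bullet> \<xi>))))"
    unfolding fourier_measure_def by (rule integral_norm_bound)
  then show ?thesis by simp
qed

text \<open>The transform times its conjugate is an integral over the product measure, in which the
  two characters combine to one in \<open>x - y\<close>.\<close>

lemma fourier_measure_norm_sq:
  "complex_of_real ((cmod (fourier_measure \<nu> \<xi>))\<^sup>2)
    = (LINT z|(\<nu> \<Otimes>\<^sub>M \<nu>). cis (- ((fst z - snd z) \<bullet> \<xi>)))"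
proof -
  have i: "integrable (\<nu> \<Otimes>\<^sub>M \<nu>) (\<lambda>(x, y). cis (- (x \<bullet> \<xi>)) * cnj (cis (- (y \<bullet> \<xi>))))"
    by (rule \<kappa>.integrable_const_bound[where B = 1]) (auto simp: norm_mult split_beta cis_cnj)
  have "complex_of_real ((cmod (fourier_measure \<nu> \<xi>))\<^sup>2) = fourier_measure \<nu> \<xi> * cnj (fourier_measure \<nu> \<xi>)"
    by (rule complex_norm_square)
  also have "\<dots> = (LINT x|\<nu>. (LINT y|\<nu>. cis (- (x \<bullet> \<xi>)) * cnj (cis (- (y \<bullet> \<xi>)))))"
    by (simp add: fourier_measure_def del: cis_cnj)
  also have "\<dots> = (LINT z|(\<nu> \<Otimes>\<^sub>M \<nu>). cis (- (fst z \<bullet> \<xi>)) * cnj (cis (- (snd z \<bullet> \<xi>))))"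
    using \<kappa>.integral_fst[OF i] by (simp only: case_prod_unfold)
  also have "\<dots> = (LINT z|(\<nu> \<Otimes>\<^sub>M \<nu>). cis (- ((fst z - snd z) \<bullet> \<xi>)))"
    by (simp add: cis_cnj cis_mult inner_diff_left)
  finally show ?thesis .
qed

text \<open>Fubini moves the frequency integral inside, where it is the Fourier transform of a
  Gaussian at \<open>x - y\<close>. The exchange is done with complex Bochner integrals and then
  transferred to nonnegative ones.\<close>

lemma fourier_measure_gaussian:
  assumes s: "0 < s"
  shows "(\<integral>\<^sup>+\<xi>. ennreal (exp (- (s * (norm \<xi>)\<^sup>2)) * (cmod (fourier_measure \<nu> \<xi>))\<^sup>2) \<partial>lborel)
    = ennreal (sqrt (pi / s) ^ DIM('a)) * (\<integral>\<^sup>+x. \<integral>\<^sup>+y. ennreal (exp (- ((dist x y)\<^sup>2 / (4 * s)))) \<partial>\<nu> \<partial>\<nu>)"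
proof -
  let ?G = "\<lambda>\<xi>::'a. exp (- (s * (norm \<xi>)\<^sup>2))" and ?\<kappa> = "\<nu> \<Otimes>\<^sub>M \<nu>"
  let ?E = "\<lambda>z::'a \<times> 'a. exp (- ((norm (fst z - snd z))\<^sup>2 / (4 * s)))"
  have G: "integrable lborel ?G"
    using integrable_norm[OF gaussian_fourier(1)[OF s, of "0::'a"]] by (simp add: norm_mult)
  have "integrable (?\<kappa> \<Otimes>\<^sub>M lborel) (\<lambda>(z, \<xi>). complex_of_real (?G \<xi>) * cis (- ((fst z - snd z) \<bullet> \<xi>)))"
  proof (rule \<kappa>l.Fubini_integrable)
    show "AE z in ?\<kappa>. integrable lborel
        (\<lambda>\<xi>. case (z, \<xi>) of (z, \<xi>) \<Rightarrow> complex_of_real (?G \<xi>) * cis (- ((fst z - snd z) \<bullet> \<xi>)))"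
      using gaussian_fourier(1)[OF s] by (intro AE_I2) simp
  qed (auto simp: norm_mult split_beta)
  note F = \<kappa>l.Fubini_integral[OF this]
  have "complex_of_real (LINT \<xi>|lborel. ?G \<xi> * (cmod (fourier_measure \<nu> \<xi>))\<^sup>2)
      = (LINT \<xi>|lborel. (LINT z|?\<kappa>. complex_of_real (?G \<xi>) * cis (- ((fst z - snd z) \<bullet> \<xi>))))"
    unfolding integral_complex_of_real[symmetric] of_real_mult fourier_measure_norm_sq by simp
  also have "\<dots> = (LINT z|?\<kappa>. (LINT \<xi>|lborel. complex_of_real (?G \<xi>) * cis (- ((fst z - snd z) \<bullet> \<xi>))))"
    by (rule F)
  also have "\<dots> = complex_of_real (LINT z|?\<kappa>. sqrt (pi / s) ^ DIM('a) * ?E z)"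
    unfolding gaussian_fourier(2)[OF s] by (rule integral_complex_of_real)
  finally have eq: "(LINT \<xi>|lborel. ?G \<xi> * (cmod (fourier_measure \<nu> \<xi>))\<^sup>2)
      = (LINT z|?\<kappa>. sqrt (pi / s) ^ DIM('a) * ?E z)"
    using of_real_eq_iff by blast
  \<comment> \<open>The transform is bounded by the total mass, so the Gaussian makes the integrand
    integrable and both kinds of integral agree.\<close>
  have "(\<integral>\<^sup>+\<xi>. ennreal (?G \<xi> * (cmod (fourier_measure \<nu> \<xi>))\<^sup>2) \<partial>lborel)
      = ennreal (LINT \<xi>|lborel. ?G \<xi> * (cmod (fourier_measure \<nu> \<xi>))\<^sup>2)"
  proof (rule nn_integral_eq_integral)
    show "integrable lborel (\<lambda>\<xi>. ?G \<xi> * (cmod (fourier_measure \<nu> \<xi>))\<^sup>2)"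
    proof (rule Bochner_Integration.integrable_bound)
      show "integrable lborel (\<lambda>\<xi>. ?G \<xi> * (measure \<nu> UNIV)\<^sup>2)"
        using G by simp
      show "AE \<xi> in lborel. norm (?G \<xi> * (cmod (fourier_measure \<nu> \<xi>))\<^sup>2) \<le> norm (?G \<xi> * (measure \<nu> UNIV)\<^sup>2)"
        by (intro AE_I2) (simp add: abs_mult power_mono fourier_measure_norm_le)
    qed simp
  qed simp
  also have "\<dots> = (\<integral>\<^sup>+z. ennreal (sqrt (pi / s) ^ DIM('a) * ?E z) \<partial>?\<kappa>)"
    unfolding eq
  proof (rule nn_integral_eq_integral[symmetric])
    have "integrable ?\<kappa> ?E"
      by (rule \<kappa>.integrable_const_bound[where B = 1]) (use s in auto)
    then show "integrable ?\<kappa> (\<lambda>z. sqrt (pi / s) ^ DIM('a) * ?E z)" by simp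
  qed (use s in simp)
  also have "\<dots> = ennreal (sqrt (pi / s) ^ DIM('a)) * (\<integral>\<^sup>+z. ennreal (?E z) \<partial>?\<kappa>)"
    using s by (simp add: ennreal_mult nn_integral_cmult)
  also have "(\<integral>\<^sup>+z. ennreal (?E z) \<partial>?\<kappa>) = (\<integral>\<^sup>+x. \<integral>\<^sup>+y. ennreal (?E (x, y)) \<partial>\<nu> \<partial>\<nu>)"
    by (rule nn_integral_fst[symmetric]) simp
  finally show ?thesis by (simp add: dist_norm)
qed

text \<open>
  On the annulus \<open>k \<surd>s \<le> |x - y| < (k + 1) \<surd>s\<close> the Gaussian is at most \<open>exp (- k\<^sup>2 / 4)\<close>.
\<close>

lemma gaussian_ball_bound:
  fixes l M s :: real
  assumes M: "0 \<le> M" and s: "0 < s"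
    and ball: "\<And>R. 0 < R \<Longrightarrow> emeasure \<nu> (ball x R) \<le> ennreal (M * R powr l)"
    and S: "(\<lambda>k. exp (- ((real k)\<^sup>2 / 4)) * real (Suc k) powr l) sums S"
  shows "(\<integral>\<^sup>+y. ennreal (exp (- ((dist x y)\<^sup>2 / (4 * s)))) \<partial>\<nu>) \<le> ennreal (M * S * s powr (l / 2))"
proof -
  let ?e = "\<lambda>k. exp (- ((real k)\<^sup>2 / 4))" and ?B = "\<lambda>k. ball x (real (Suc k) * sqrt s)"
  have "(\<integral>\<^sup>+y. ennreal (exp (- ((dist x y)\<^sup>2 / (4 * s)))) \<partial>\<nu>)
      \<le> (\<integral>\<^sup>+y. (\<Sum>k. ennreal (?e k) * indicator (?B k) y) \<partial>\<nu>)"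
  proof (rule nn_integral_mono)
    fix y
    \<comment> \<open>\<open>d\<close> is the distance in units of \<open>sqrt s\<close>. Its
      integer part selects the annulus, and \<open>d < Suc k\<close> is strict, as the open ball
      demands.\<close>
    define d where "d = dist x y / sqrt s"
    define k where "k = nat \<lfloor>d\<rfloor>"
    have d: "0 \<le> d" "dist x y = d * sqrt s" using s by (auto simp: d_def)
    have k: "real k \<le> d" "d < real (Suc k)" using d(1) unfolding k_def by linarith+
    have "y \<in> ?B k" using k(2) s by (simp add: d(2))
    have "exp (- ((dist x y)\<^sup>2 / (4 * s))) = exp (- (d\<^sup>2 / 4))"
      using s by (simp add: d(2) power_mult_distrib)
    also have "\<dots> \<le> ?e k"
      using k(1) by (simp add: power_mono)
    finally have "ennreal (exp (- ((dist x y)\<^sup>2 / (4 * s)))) \<le> ennreal (?e k) * indicator (?B k) y"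
      using \<open>y \<in> ?B k\<close> by (simp add: ennreal_leI)
    also have "\<dots> = (\<Sum>k\<in>{k}. ennreal (?e k) * indicator (?B k) y)"
      by (simp only: sum.insert[OF finite.emptyI] empty_iff sum.empty add_0_right not_False_eq_True)
    also have "\<dots> \<le> (\<Sum>k. ennreal (?e k) * indicator (?B k) y)"
      by (rule sum_le_suminf) auto
    finally show "ennreal (exp (- ((dist x y)\<^sup>2 / (4 * s)))) \<le> \<dots>" .
  qed
  also have "\<dots> = (\<Sum>k. ennreal (?e k) * emeasure \<nu> (?B k))"
  proof -
    have [measurable]: "?B k \<in> sets \<nu>" for k
      by (simp add: borel_open)
    have "(\<integral>\<^sup>+y. (\<Sum>k. ennreal (?e k) * indicator (?B k) y) \<partial>\<nu>)
        = (\<Sum>k. \<integral>\<^sup>+y. ennreal (?e k) * indicator (?B k) y \<partial>\<nu>)"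
      by (rule nn_integral_suminf) measurable
    also have "\<dots> = (\<Sum>k. ennreal (?e k) * emeasure \<nu> (?B k))"
      by (intro suminf_cong nn_integral_cmult_indicator) measurable
    finally show ?thesis .
  qed
  also have "\<dots> \<le> (\<Sum>k. ennreal (M * s powr (l / 2) * (?e k * real (Suc k) powr l)))"
  proof (rule suminf_le)
    fix k
    have "ennreal (?e k) * emeasure \<nu> (?B k) \<le> ennreal (?e k) * ennreal (M * (real (Suc k) * sqrt s) powr l)"
      using s by (intro mult_left_mono ball) auto
    also have "\<dots> = ennreal (?e k * (M * (real (Suc k) * sqrt s) powr l))"
      by (simp add: ennreal_mult M)
    \<comment> \<open>The dependence on \<open>s\<close> factors out as
      \<open>s powr (l / 2)\<close>, leaving the series with sum \<open>S\<close>.\<close>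
    also have "(real (Suc k) * sqrt s) powr l = real (Suc k) powr l * s powr (l / 2)"
      using s by (simp add: powr_mult powr_half_sqrt[symmetric] powr_powr del: of_nat_Suc)
    finally show "ennreal (?e k) * emeasure \<nu> (?B k) \<le> ennreal (M * s powr (l / 2) * (?e k * real (Suc k) powr l))"
      by (simp only: mult_ac)
  qed auto
  also have "\<dots> = ennreal (M * s powr (l / 2) * S)"
    using S by (intro suminf_ennreal_eq sums_mult) (auto simp: M)
  finally show ?thesis by (simp only: mult_ac)
qed

text \<open>For each \<open>s\<close> the ball condition bounds the inner integral and the outer one
  adds only the total mass. With \<open>n\<close> the dimension, the energy is
  \<open>O(s powr ((l - n) / 2))\<close>, and the weight \<open>exp (- s)\<close> turns this into a
  Gamma integral whose argument is positive by \<open>n - 2 < l\<close>.\<close>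

lemma fourier_measure_sqnorm_bound:
  fixes l M S :: real
  assumes M: "0 \<le> M" and l: "real DIM('a) - 2 < l"
    and ball: "\<And>x R. 0 < R \<Longrightarrow> emeasure \<nu> (ball x R) \<le> ennreal (M * R powr l)"
    and S: "(\<lambda>k. exp (- ((real k)\<^sup>2 / 4)) * real (Suc k) powr l) sums S" "0 \<le> S"
  shows "(\<integral>\<^sup>+\<xi>. ennreal ((cmod (fourier_measure \<nu> \<xi>))\<^sup>2 / (1 + (norm \<xi>)\<^sup>2)) \<partial>lborel)
    \<le> ennreal (sqrt pi ^ DIM('a) * S * Gamma ((l - real DIM('a)) / 2 + 1) * M * measure \<nu> UNIV)"
proof -
  let ?F = "\<lambda>\<xi>. (cmod (fourier_measure \<nu> \<xi>))\<^sup>2" and ?n = "real DIM('a)"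
  let ?K = "sqrt pi ^ DIM('a) * S * M * measure \<nu> UNIV"
  have K: "0 \<le> ?K" using S(2) M by simp
  have inv: "ennreal (?F \<xi> / (1 + (norm \<xi>)\<^sup>2))
      = (\<integral>\<^sup>+s. ennreal (exp (- s)) * indicator {0..} s * ennreal (exp (- (s * (norm \<xi>)\<^sup>2)) * ?F \<xi>) \<partial>lborel)" for \<xi>
  proof -
    let ?a = "1 + (norm \<xi>)\<^sup>2"
    have a: "0 < ?a" by (simp add: add_pos_nonneg)
    \<comment> \<open>\<open>exp (- ?a * 0)\<close> is the value at the lower endpoint in the
      formula for the integral of \<open>exp (- ?a * s)\<close> over \<open>s \<ge> 0\<close>; it
      equals 1.\<close>
    have "ennreal (exp (- ?a * 0) / ?a) = (\<integral>\<^sup>+s. ennreal (exp (- ?a * s)) * indicator {0..} s \<partial>lborel)"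
      by (rule nn_integral_has_integral_lebesgue'[symmetric, OF _ has_integral_exp_minus_to_infinity[OF a]]) simp
    moreover have "ennreal (?F \<xi> / ?a) = ennreal (?F \<xi>) * ennreal (exp (- ?a * 0) / ?a)"
      by (simp flip: ennreal_mult')
    ultimately have "ennreal (?F \<xi> / ?a) = ennreal (?F \<xi>) * (\<integral>\<^sup>+s. ennreal (exp (- ?a * s)) * indicator {0..} s \<partial>lborel)"
      by (simp only:)
    also have "\<dots> = (\<integral>\<^sup>+s. ennreal (?F \<xi>) * (ennreal (exp (- ?a * s)) * indicator {0..} s) \<partial>lborel)"
      by (rule nn_integral_cmult[symmetric]) simp
    also have "\<dots> = (\<integral>\<^sup>+s. ennreal (exp (- s)) * indicator {0..} s * ennreal (exp (- (s * (norm \<xi>)\<^sup>2)) * ?F \<xi>) \<partial>lborel)"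
    proof (rule nn_integral_cong)
      fix s :: real
      have "?F \<xi> * exp (- ?a * s) = exp (- s) * (exp (- (s * (norm \<xi>)\<^sup>2)) * ?F \<xi>)"
        by (simp add: algebra_simps flip: exp_add)
      then show "ennreal (?F \<xi>) * (ennreal (exp (- ?a * s)) * indicator {0..} s)
          = ennreal (exp (- s)) * indicator {0..} s * ennreal (exp (- (s * (norm \<xi>)\<^sup>2)) * ?F \<xi>)"
        by (cases "s \<ge> 0") (simp_all flip: ennreal_mult)
    qed
    finally show ?thesis .
  qed
  have "(\<integral>\<^sup>+\<xi>. ennreal (?F \<xi> / (1 + (norm \<xi>)\<^sup>2)) \<partial>lborel)
      = (\<integral>\<^sup>+s. (\<integral>\<^sup>+\<xi>. ennreal (exp (- s)) * indicator {0..} s * ennreal (exp (- (s * (norm \<xi>)\<^sup>2)) * ?F \<xi>) \<partial>lborel) \<partial>lborel)"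
    unfolding inv by (rule lborel_pair.Fubini'[symmetric]) simp
  also have "\<dots> = (\<integral>\<^sup>+s. ennreal (exp (- s)) * indicator {0..} s *
      (\<integral>\<^sup>+\<xi>. ennreal (exp (- (s * (norm \<xi>)\<^sup>2)) * ?F \<xi>) \<partial>lborel) \<partial>lborel)"
    by (intro nn_integral_cong nn_integral_cmult) simp
  \<comment> \<open>The exponent keeps the form \<open>z - 1\<close> so that the right side contains
    the Gamma integrand at \<open>z\<close>.\<close>
  also have "\<dots> \<le> (\<integral>\<^sup>+t. ennreal ?K * ennreal (indicator {0..} t * t powr (((l - ?n) / 2 + 1) - 1) / exp t) \<partial>lborel)"
  proof (rule nn_integral_mono_AE)
    \<comment> \<open>The Gaussian bound needs \<open>0 < s\<close>; the point 0 is null, and for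
      negative \<open>s\<close> the indicator vanishes.\<close>
    have "AE s in lborel. s \<noteq> (0::real)" by (rule AE_lborel_singleton)
    then show "AE s in lborel. ennreal (exp (- s)) * indicator {0..} s *
        (\<integral>\<^sup>+\<xi>. ennreal (exp (- (s * (norm \<xi>)\<^sup>2)) * ?F \<xi>) \<partial>lborel)
      \<le> ennreal ?K * ennreal (indicator {0..} s * s powr (((l - ?n) / 2 + 1) - 1) / exp s)"
    proof eventually_elim
      case (elim s)
      show ?case
      proof (cases "0 < s")
        case s: True
        have "(\<integral>\<^sup>+x. \<integral>\<^sup>+y. ennreal (exp (- ((dist x y)\<^sup>2 / (4 * s)))) \<partial>\<nu> \<partial>\<nu>)
            \<le> (\<integral>\<^sup>+x. ennreal (M * S * s powr (l / 2)) \<partial>\<nu>)"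
          by (intro nn_integral_mono gaussian_ball_bound M s ball S)
        also have "\<dots> = ennreal (M * S * s powr (l / 2) * measure \<nu> UNIV)"
          using M S(2) by (simp add: emeasure_eq_measure ennreal_mult)
        finally have "(\<integral>\<^sup>+\<xi>. ennreal (exp (- (s * (norm \<xi>)\<^sup>2)) * ?F \<xi>) \<partial>lborel)
            \<le> ennreal (sqrt (pi / s) ^ DIM('a)) * ennreal (M * S * s powr (l / 2) * measure \<nu> UNIV)"
          unfolding fourier_measure_gaussian[OF s] by (rule mult_left_mono) simp
        also have "\<dots> = ennreal (sqrt (pi / s) ^ DIM('a) * (M * S * s powr (l / 2) * measure \<nu> UNIV))"
          using s by (simp add: ennreal_mult')
        also have "sqrt (pi / s) ^ DIM('a) * (M * S * s powr (l / 2) * measure \<nu> UNIV)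
            = ?K * s powr ((l - ?n) / 2)"
        proof -
          \<comment> \<open>The denominator of \<open>sqrt (pi / s) ^ DIM('a)\<close> lowers the
            exponent from \<open>l / 2\<close> to \<open>(l - ?n) / 2\<close>.\<close>
          have "sqrt s ^ DIM('a) = s powr (?n / 2)"
            using s by (simp add: powr_half_sqrt[symmetric] powr_powr flip: powr_realpow)
          then have "s powr (l / 2) / sqrt s ^ DIM('a) = s powr ((l - ?n) / 2)"
            by (simp add: powr_diff[symmetric] diff_divide_distrib)
          from this[symmetric] show ?thesis
            by (simp add: real_sqrt_divide power_divide)
        qed
        finally have "(\<integral>\<^sup>+\<xi>. ennreal (exp (- (s * (norm \<xi>)\<^sup>2)) * ?F \<xi>) \<partial>lborel)
            \<le> ennreal (?K * s powr ((l - ?n) / 2))" .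
        then have "ennreal (exp (- s)) * (\<integral>\<^sup>+\<xi>. ennreal (exp (- (s * (norm \<xi>)\<^sup>2)) * ?F \<xi>) \<partial>lborel)
            \<le> ennreal (exp (- s)) * ennreal (?K * s powr ((l - ?n) / 2))"
          by (rule mult_left_mono) simp
        also have "\<dots> = ennreal (exp (- s) * (?K * s powr ((l - ?n) / 2)))"
          by (rule ennreal_mult'[symmetric]) simp
        also have "exp (- s) * (?K * s powr ((l - ?n) / 2)) = ?K * (s powr ((l - ?n) / 2) / exp s)"
          by (simp only: exp_minus divide_inverse mult_ac)
        also have "ennreal \<dots> = ennreal ?K * ennreal (s powr ((l - ?n) / 2) / exp s)"
          by (rule ennreal_mult'[OF K])
        finally show ?thesis using s by simp
      qed (use elim in simp)
    qed
  qed
  also have "\<dots> = ennreal ?K * ennreal (Gamma ((l - ?n) / 2 + 1))"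
  proof -
    have "0 < (l - ?n) / 2 + 1" using l by (simp add: field_simps)
    then show ?thesis
      by (simp only: Gamma_conv_nn_integral_real) (rule nn_integral_cmult, measurable)
  qed
  also have "\<dots> = ennreal (?K * Gamma ((l - ?n) / 2 + 1))"
    using K by (simp add: ennreal_mult')
  finally show ?thesis by (simp only: mult_ac)
qed

end

text \<open>Gaussian decay beats every power, so comparison with \<open>1 / k^2\<close>
  suffices.\<close>

lemma gauss_powr_summable:
  "summable (\<lambda>k. exp (- ((real k)\<^sup>2 / 4)) * real (Suc k) powr l)"
proof (rule summable_comparison_test_bigo)
  show "summable (\<lambda>k. norm (1 / real k ^ 2))"
    using inverse_power_summable[of 2, where 'a = real] by (simp add: field_simps)
  show "(\<lambda>k. exp (- ((real k)\<^sup>2 / 4)) * real (Suc k) powr l) \<in> O(\<lambda>k. 1 / real k ^ 2)"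
    by real_asymp
qed

text \<open>The kernel is symmetric in \<open>x\<close> and \<open>\<xi>\<close> and has modulus 1,
  so Fubini moves the transform from \<open>\<phi>\<close> to \<open>\<nu>\<close>. Both transforms
  share sign and normalization, hence no constant appears.\<close>

lemma integral_fourier:
  fixes \<nu> :: "'a::euclidean_space measure"
  assumes fin: "finite_measure \<nu>" and sets [measurable_cong]: "sets \<nu> = sets borel"
    and \<phi>: "integrable lborel \<phi>"
  shows "(LINT \<xi>|\<nu>. fourier \<phi> \<xi>) = (LINT x|lborel. fourier_measure \<nu> x * \<phi> x)"
proof -
  interpret finite_measure \<nu> by (rule fin)
  interpret pair_sigma_finite \<nu> "lborel :: 'a measure" ..
  have [measurable]: "\<phi> \<in> borel_measurable borel"
    using borel_measurable_integrable[OF \<phi>] by simp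
  have "integrable (\<nu> \<Otimes>\<^sub>M lborel) (\<lambda>(\<xi>, x). cis (- (x \<bullet> \<xi>)) * \<phi> x)"
  proof (rule Fubini_integrable)
    show "AE \<xi> in \<nu>. integrable lborel (\<lambda>x. case (\<xi>, x) of (\<xi>, x) \<Rightarrow> cis (- (x \<bullet> \<xi>)) * \<phi> x)"
    proof (rule AE_I2)
      fix \<xi>
      show "integrable lborel (\<lambda>x. case (\<xi>, x) of (\<xi>, x) \<Rightarrow> cis (- (x \<bullet> \<xi>)) * \<phi> x)"
        by (rule Bochner_Integration.integrable_bound[OF \<phi>]) (auto simp: norm_mult)
    qed
  qed (auto simp: norm_mult)
  from Fubini_integral[OF this] show ?thesis
    by (simp add: fourier_def fourier_measure_def inner_commute)
qed

section \<open>Positive and negative parts of Morrey measures\<close>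

text \<open>A set competing for the positive variation is, alone, a family competing for the total
  variation.\<close>

lemma pos_var_le_total_var: "pos_var \<mu> A \<le> total_var \<mu> A"
  unfolding pos_var_def
proof (rule SUP_least)
  fix B assume "B \<in> {B \<in> bounded_borel. B \<subseteq> A}"
  then have "(\<Sum>B\<in>{B}. ennreal \<bar>\<mu> B\<bar>) \<le> total_var \<mu> A"
    unfolding total_var_def by (intro SUP_upper) auto
  moreover have "ennreal (\<mu> B) \<le> ennreal \<bar>\<mu> B\<bar>" by (rule ennreal_leI) simp
  ultimately show "ennreal (\<mu> B) \<le> total_var \<mu> A" by (simp only: sum.insert[OF finite.emptyI] empty_iff sum.empty add_0_right not_False_eq_True)
qed

text \<open>Invariance under sign change lets estimates for \<open>pos_part\<close> be reused for
  \<open>neg_part \<mu>\<close>, the positive part of \<open>- \<mu>\<close>.\<close>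

lemma total_var_uminus: "total_var (\<lambda>A. - \<mu> A) = total_var \<mu>"
  by (simp add: total_var_def fun_eq_iff)

lemma signed_radon_uminus: "signed_radon \<mu> \<Longrightarrow> signed_radon (\<lambda>A. - \<mu> A)"
  by (simp add: signed_radon_def sums_minus)

lemma emeasure_pos_part_le:
  assumes "signed_radon \<mu>" "A \<in> sets borel"
  shows "emeasure (pos_part \<mu>) A \<le> total_var \<mu> A"
  using emeasure_pos_part[OF assms] pos_var_le_total_var[of \<mu> A] by simp

lemma finite_measure_pos_part:
  assumes "\<mu> \<in> bounded_radon"
  shows "finite_measure (pos_part \<mu>)"
proof
  have "emeasure (pos_part \<mu>) UNIV \<le> total_var \<mu> UNIV"
    using assms by (intro emeasure_pos_part_le) (auto simp: bounded_radon_def)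
  then show "emeasure (pos_part \<mu>) (space (pos_part \<mu>)) \<noteq> \<infinity>"
    using assms by (auto simp: bounded_radon_def top_unique)
qed

lemma bounded_radon_uminus: "\<mu> \<in> bounded_radon \<Longrightarrow> (\<lambda>A. - \<mu> A) \<in> bounded_radon"
  by (simp add: bounded_radon_def signed_radon_uminus total_var_uminus)

lemma finite_measure_neg_part: "\<mu> \<in> bounded_radon \<Longrightarrow> finite_measure (neg_part \<mu>)"
  unfolding neg_part_def by (intro finite_measure_pos_part bounded_radon_uminus)

lemma sets_neg_part: "sets (neg_part \<mu>) = sets borel"
  by (simp add: neg_part_def)

lemma morrey_norm_uminus: "morrey_norm p (\<lambda>A. - \<mu> A) = morrey_norm p \<mu>"
  by (simp add: morrey_norm_def total_var_uminus)

lemma morrey_on_uminus: "\<mu> \<in> morrey_on p \<Omega> \<Longrightarrow> (\<lambda>A. - \<mu> A) \<in> morrey_on p \<Omega>"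
  by (simp add: morrey_on_def morrey_def supported_in_def signed_radon_uminus total_var_uminus morrey_norm_uminus)

text \<open>Both suprema in the norm are taken at the given \<open>R\<close> and \<open>x\<close>;
  multiplying by \<open>R powr ?l\<close> undoes the weight.\<close>

lemma total_var_ball_le:
  fixes \<mu> :: "'a::euclidean_space set \<Rightarrow> real"
  assumes "morrey_norm p \<mu> < \<infinity>" "0 < R"
  shows "total_var \<mu> (ball x R)
    \<le> ennreal (enn2real (morrey_norm p \<mu>) * R powr (real DIM('a) * (1 - real_of_ereal (1 / p))))"
proof -
  let ?l = "real DIM('a) * (1 - real_of_ereal (1 / p))"
  have "ennreal (R powr - ?l) * total_var \<mu> (ball x R) \<le> ennreal (R powr - ?l) * (SUP x. total_var \<mu> (ball x R))"
    by (intro mult_left_mono SUP_upper) auto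
  also have "\<dots> \<le> morrey_norm p \<mu>"
    unfolding morrey_norm_def using assms(2) by (intro SUP_upper) auto
  finally have "ennreal (R powr ?l) * (ennreal (R powr - ?l) * total_var \<mu> (ball x R))
      \<le> ennreal (R powr ?l) * morrey_norm p \<mu>"
    by (intro mult_left_mono) auto
  also have "ennreal (R powr ?l) * (ennreal (R powr - ?l) * total_var \<mu> (ball x R)) = total_var \<mu> (ball x R)"
    using assms(2) by (simp add: mult.assoc[symmetric] powr_minus flip: ennreal_mult')
  also have "ennreal (R powr ?l) * morrey_norm p \<mu> = ennreal (enn2real (morrey_norm p \<mu>) * R powr ?l)"
    using assms(1) by (simp add: ennreal_mult mult.commute)
  finally show ?thesis .
qed

text \<open>The null set \<open>N\<close> from \<open>supported_in\<close> and the ball around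
  \<open>\<Omega>\<close> together cover the space, so one ball carries the whole mass.\<close>

lemma measure_pos_part_le:
  fixes \<mu> :: "'a::euclidean_space set \<Rightarrow> real"
  assumes \<mu>: "\<mu> \<in> morrey_on p \<Omega>" and \<Omega>: "\<Omega> \<subseteq> ball 0 R" and R: "0 < R"
  shows "measure (pos_part \<mu>) UNIV
    \<le> enn2real (morrey_norm p \<mu>) * R powr (real DIM('a) * (1 - real_of_ereal (1 / p)))"
proof -
  have r: "signed_radon \<mu>" "morrey_norm p \<mu> < \<infinity>" "supported_in \<mu> \<Omega>"
    using \<mu> by (auto simp: morrey_on_def morrey_def)
  then obtain N where N: "N \<in> sets borel" "- \<Omega> \<subseteq> N" "total_var \<mu> N = 0"
    by (auto simp: supported_in_def)
  have "emeasure (pos_part \<mu>) UNIV \<le> emeasure (pos_part \<mu>) (N \<union> ball 0 R)"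
    using N(1,2) \<Omega> by (intro emeasure_mono) (auto simp: borel_open)
  also have "\<dots> \<le> emeasure (pos_part \<mu>) N + emeasure (pos_part \<mu>) (ball 0 R)"
    using N(1) by (intro emeasure_subadditive) (auto simp: borel_open)
  also have "\<dots> \<le> total_var \<mu> N + total_var \<mu> (ball 0 R)"
    using r(1) N(1) by (intro add_mono emeasure_pos_part_le) (auto simp: borel_open)
  also have "\<dots> \<le> ennreal (enn2real (morrey_norm p \<mu>) * R powr (real DIM('a) * (1 - real_of_ereal (1 / p))))"
    using total_var_ball_le[OF r(2) R] by (simp add: N(3))
  finally show ?thesis
    unfolding measure_def by (intro enn2real_leI) auto
qed

text \<open>The Morrey norm enters twice, as the constant in the ball condition and through the
  total mass; hence its square.\<close>

lemma pos_part_sqnorm_bound: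
  fixes \<mu> :: "'a::euclidean_space set \<Rightarrow> real" and p :: ereal
  defines "l \<equiv> real DIM('a) * (1 - real_of_ereal (1 / p))"
  assumes \<mu>: "\<mu> \<in> morrey_on p \<Omega> \<inter> bounded_radon" and \<Omega>: "\<Omega> \<subseteq> ball 0 R" and R: "0 < R"
    and l: "real DIM('a) - 2 < l"
    and S: "(\<lambda>k. exp (- ((real k)\<^sup>2 / 4)) * real (Suc k) powr l) sums S" "0 \<le> S"
  shows "(\<integral>\<^sup>+\<xi>. ennreal ((cmod (fourier_measure (pos_part \<mu>) \<xi>))\<^sup>2 / (1 + (norm \<xi>)\<^sup>2)) \<partial>lborel)
    \<le> ennreal (sqrt pi ^ DIM('a) * S * Gamma ((l - real DIM('a)) / 2 + 1) * R powr l * (enn2real (morrey_norm p \<mu>))\<^sup>2)"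
proof -
  let ?M = "enn2real (morrey_norm p \<mu>)" and ?G = "Gamma ((l - real DIM('a)) / 2 + 1)"
  have r: "signed_radon \<mu>" "morrey_norm p \<mu> < \<infinity>"
    using \<mu> by (auto simp: morrey_on_def morrey_def)
  have "emeasure (pos_part \<mu>) (ball x r) \<le> ennreal (?M * r powr l)" if "0 < r" for x r
    using emeasure_pos_part_le[OF r(1), of "ball x r"] total_var_ball_le[OF r(2) that, of x]
    by (simp add: l_def borel_open)
  then have "(\<integral>\<^sup>+\<xi>. ennreal ((cmod (fourier_measure (pos_part \<mu>) \<xi>))\<^sup>2 / (1 + (norm \<xi>)\<^sup>2)) \<partial>lborel)
      \<le> ennreal (sqrt pi ^ DIM('a) * S * ?G * ?M * measure (pos_part \<mu>) UNIV)"
    using \<mu> l S by (intro fourier_measure_sqnorm_bound finite_measure_pos_part) auto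
  also have "\<dots> \<le> ennreal (sqrt pi ^ DIM('a) * S * ?G * ?M * (?M * R powr l))"
  proof (intro ennreal_leI mult_left_mono)
    show "measure (pos_part \<mu>) UNIV \<le> ?M * R powr l"
      using \<mu> \<Omega> R unfolding l_def by (intro measure_pos_part_le) auto
    have "0 < ?G" using l by (intro Gamma_real_pos) (simp add: field_simps)
    then show "0 \<le> sqrt pi ^ DIM('a) * S * ?G * ?M"
      using S(2) by simp
  qed
  finally show ?thesis by (simp add: power2_eq_square mult_ac)
qed

section \<open>Measures as tempered distributions and their Fourier transforms\<close>

lemma schwartz_continuous: "schwartz \<phi> \<Longrightarrow> continuous_on A \<phi>"
  by (simp add: schwartz_def smooth_continuous)

text \<open>A real supremum is an upper bound only for a set bounded above; this boundedness is part
  of \<open>schwartz\<close>.\<close>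

lemma schwartz_norm_le:
  assumes "schwartz \<phi>"
  shows "cmod (\<phi> x) \<le> schwartz_seminorm 0 [] \<phi>"
proof -
  have "bounded (range (\<lambda>x. (1 + norm x) ^ 0 *\<^sub>R partial_deriv [] \<phi> x))"
    using assms unfolding schwartz_def by blast
  then have "bounded (range (\<lambda>x. cmod (\<phi> x)))"
    by (auto simp: bounded_iff)
  then have "bdd_above (range (\<lambda>x. cmod (\<phi> x)))" by (rule bounded_imp_bdd_above)
  then show ?thesis
    unfolding schwartz_seminorm_def by (auto intro: cSUP_upper)
qed

lemma schwartz_integrable:
  assumes "schwartz \<phi>" "finite_measure \<nu>" "sets \<nu> = sets borel"
  shows "integrable \<nu> \<phi>"
proof (rule finite_measure.integrable_const_bound[OF assms(2)])
  show "\<phi> \<in> borel_measurable \<nu>"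
    using borel_measurable_continuous_onI[OF schwartz_continuous[OF assms(1)]]
      measurable_cong_sets[OF assms(3) refl] by blast
qed (use schwartz_norm_le[OF assms(1)] in auto)

text \<open>Against a finite measure the integral is at most the total mass times the sup norm,
  which is the seminorm without weight and derivatives.\<close>

lemma schwartz_integral_tendsto_0:
  assumes "\<And>m. schwartz (\<phi> m)" "(\<lambda>m. schwartz_seminorm 0 [] (\<phi> m)) \<longlonglongrightarrow> 0"
    and \<nu>: "finite_measure \<nu>" "sets \<nu> = sets borel"
  shows "(\<lambda>m. integral\<^sup>L \<nu> (\<phi> m)) \<longlonglongrightarrow> 0"
proof (rule Lim_null_comparison)
  have "norm (integral\<^sup>L \<nu> (\<phi> m)) \<le> schwartz_seminorm 0 [] (\<phi> m) * measure \<nu> (space \<nu>)" for m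
  proof -
    have "norm (integral\<^sup>L \<nu> (\<phi> m)) \<le> (LINT x|\<nu>. cmod (\<phi> m x))"
      by (rule integral_norm_bound)
    also have "\<dots> \<le> (LINT x|\<nu>. schwartz_seminorm 0 [] (\<phi> m))"
      using schwartz_integrable[OF assms(1) \<nu>] finite_measure.integrable_const[OF \<nu>(1)]
      by (intro integral_mono schwartz_norm_le assms) auto
    finally show ?thesis by (simp add: mult.commute)
  qed
  then show "\<forall>\<^sub>F m in sequentially. norm (integral\<^sup>L \<nu> (\<phi> m)) \<le> schwartz_seminorm 0 [] (\<phi> m) * measure \<nu> (space \<nu>)"
    by simp
  show "(\<lambda>m. schwartz_seminorm 0 [] (\<phi> m) * measure \<nu> (space \<nu>)) \<longlonglongrightarrow> 0"
    using tendsto_mult_left_zero[OF assms(2)] .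
qed

lemma tempered_distribution_of_measure:
  assumes "\<mu> \<in> bounded_radon"
  shows "tempered_distribution (distr_of_measure \<mu>)"
proof -
  note fin = finite_measure_pos_part[OF assms] finite_measure_neg_part[OF assms]
  note sets = sets_pos_part[of \<mu>] sets_neg_part[of \<mu>]
  note i = schwartz_integrable[OF _ fin(1) sets(1)] schwartz_integrable[OF _ fin(2) sets(2)]
  note t = schwartz_integral_tendsto_0[OF _ _ fin(1) sets(1)] schwartz_integral_tendsto_0[OF _ _ fin(2) sets(2)]
  show ?thesis
    unfolding tempered_distribution_def distr_of_measure_def signed_integral_def
  proof (intro conjI allI impI)
    fix \<phi> :: "nat \<Rightarrow> 'a \<Rightarrow> complex"
    assume "\<forall>m. schwartz (\<phi> m)" "\<forall>k. \<forall>bs\<in>lists Basis. (\<lambda>m. schwartz_seminorm k bs (\<phi> m)) \<longlonglongrightarrow> 0"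
    then show "(\<lambda>m. integral\<^sup>L (pos_part \<mu>) (\<phi> m) - integral\<^sup>L (neg_part \<mu>) (\<phi> m)) \<longlonglongrightarrow> 0"
      using tendsto_diff[OF t] by simp
  qed (simp_all add: i algebra_simps)
qed

text \<open>The Fubini duality is applied to both parts. The transform of a finite measure is
  bounded, hence locally integrable.\<close>

lemma fourier_distr_of_measure:
  assumes \<mu>: "\<mu> \<in> bounded_radon"
  shows "is_function (fourier_distr (distr_of_measure \<mu>))
    (\<lambda>\<xi>. fourier_measure (pos_part \<mu>) \<xi> - fourier_measure (neg_part \<mu>) \<xi>)"
proof -
  note fin = finite_measure_pos_part[OF assms] finite_measure_neg_part[OF assms]
  note sets = sets_pos_part[of \<mu>] sets_neg_part[of \<mu>]
  have loc: "locally_integrable (fourier_measure \<nu>)"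
    if \<nu>: "finite_measure \<nu>" "sets \<nu> = sets borel" for \<nu> :: "'a measure"
    unfolding locally_integrable_def set_integrable_def
  proof (intro allI impI)
    fix K :: "'a set" assume K: "compact K"
    note [measurable] = fourier_measure_measurable[OF \<nu>] borel_compact[OF K]
    show "integrable lborel (\<lambda>x. indicator K x *\<^sub>R fourier_measure \<nu> x)"
    proof (rule Bochner_Integration.integrable_bound)
      show "integrable lborel (\<lambda>x. indicator K x *\<^sub>R measure \<nu> UNIV)"
        by (rule borel_integrable_compact[OF K]) simp
    qed (auto simp: indicator_def fourier_measure_norm_le[OF \<nu>])
  qed
  note L = loc[OF fin(1) sets(1)] loc[OF fin(2) sets(2)]
  show ?thesis
    unfolding is_function_def
  proof (intro conjI allI impI)
    show "locally_integrable (\<lambda>\<xi>. fourier_measure (pos_part \<mu>) \<xi> - fourier_measure (neg_part \<mu>) \<xi>)"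
      using L by (auto simp: locally_integrable_def)
    fix \<phi> :: "'a \<Rightarrow> complex" assume \<phi>: "test_function \<phi>"
    then have "integrable lborel \<phi>" by (rule test_function_bounded_integrable)
    then show "fourier_distr (distr_of_measure \<mu>) \<phi>
        = (LINT \<xi>|lborel. (fourier_measure (pos_part \<mu>) \<xi> - fourier_measure (neg_part \<mu>) \<xi>) * \<phi> \<xi>)"
      using locally_integrable_mult_test_function[OF L(1) \<phi>] locally_integrable_mult_test_function[OF L(2) \<phi>]
      by (simp add: fourier_distr_def distr_of_measure_def signed_integral_def left_diff_distrib
          integral_fourier[OF fin(1) sets(1)] integral_fourier[OF fin(2) sets(2)])
  qed
qed

text \<open>The representative picked by \<open>SOME\<close> agrees with \<open>g\<close> almost
  everywhere, so the norm can be computed from any explicit representative.\<close>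

lemma Hm1_sqnorm_is_function:
  assumes "is_function (fourier_distr T) g"
  shows "Hm1_sqnorm T = (\<integral>\<^sup>+\<xi>. ennreal ((cmod (g \<xi>))\<^sup>2 / (1 + (norm \<xi>)\<^sup>2)) \<partial>lborel)"
proof -
  have "is_function (fourier_distr T) (fourier_fun T)"
    unfolding fourier_fun_def by (rule someI[of "is_function (fourier_distr T)", OF assms])
  from is_function_unique[OF this assms]
  have "AE \<xi> in lborel. ennreal ((cmod (fourier_fun T \<xi>))\<^sup>2 / (1 + (norm \<xi>)\<^sup>2))
      = ennreal ((cmod (g \<xi>))\<^sup>2 / (1 + (norm \<xi>)\<^sup>2))"
    by eventually_elim simp
  then show ?thesis unfolding Hm1_sqnorm_def by (rule nn_integral_cong_AE)
qed

section \<open>Assembly of the embedding\<close>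

lemma norm_diff_sq_le: "(norm (a - b))\<^sup>2 \<le> 2 * (norm a)\<^sup>2 + 2 * (norm b)\<^sup>2"
proof -
  have "(norm (a - b))\<^sup>2 \<le> (norm a + norm b)\<^sup>2"
    by (intro power_mono norm_triangle_ineq4 norm_ge_zero)
  also have "\<dots> \<le> 2 * (norm a)\<^sup>2 + 2 * (norm b)\<^sup>2"
    using zero_le_power2[of "norm a - norm b"] by (simp add: power2_sum power2_diff)
  finally show ?thesis .
qed

text \<open>The claim amounts to \<open>n / p < 2\<close>, which for finite \<open>p\<close> is the
  hypothesis. For \<open>p = \<infinity>\<close> the term \<open>1 / p\<close> is 0, and
  \<open>p = - \<infinity>\<close> is excluded by assumption.\<close>

lemma morrey_exponent_bound:
  fixes p :: ereal
  assumes "0 < n" "ereal (n / 2) < p"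
  shows "n - 2 < n * (1 - real_of_ereal (1 / p))"
proof (cases p)
  case (real r)
  then have r: "n / 2 < r" using assms by simp
  then have "0 < r" using assms(1) by linarith
  then have "n * (1 / r) < 2" using r by (simp add: field_simps)
  moreover have "real_of_ereal (1 / p) = 1 / r" using real \<open>0 < r\<close> by (simp add: one_ereal_def)
  ultimately show ?thesis by (simp add: right_diff_distrib)
qed (use assms in auto)

theorem theorem3p4:
  fixes \<Omega> :: "'a::euclidean_space set" and p :: ereal
  assumes "bounded \<Omega>" and "ereal (real DIM('a) / 2) < p"
  shows "\<exists>C::real. \<forall>\<mu> \<in> morrey_on p \<Omega> \<inter> bounded_radon.
           distr_of_measure \<mu> \<in> Hm1 \<and>
           Hm1_norm (distr_of_measure \<mu>) \<le> C * enn2real (morrey_norm p \<mu>)"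
proof -
  define l where "l = real DIM('a) * (1 - real_of_ereal (1 / p))"
  define S where "S = (\<Sum>k. exp (- ((real k)\<^sup>2 / 4)) * real (Suc k) powr l)"
  obtain R where R: "0 < R" "\<Omega> \<subseteq> ball 0 R"
    using bounded_subset_ballD[OF assms(1)] by blast
  \<comment> \<open>All factors depend only on \<open>\<Omega>\<close>, \<open>p\<close> and the
    dimension, so \<open>C\<close> serves every \<open>\<mu>\<close>.\<close>
  define C where "C = sqrt pi ^ DIM('a) * S * Gamma ((l - real DIM('a)) / 2 + 1) * R powr l"
  have l: "real DIM('a) - 2 < l"
    unfolding l_def using assms(2) by (intro morrey_exponent_bound) auto
  have S: "(\<lambda>k. exp (- ((real k)\<^sup>2 / 4)) * real (Suc k) powr l) sums S" "0 \<le> S"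
    unfolding S_def by (rule summable_sums[OF gauss_powr_summable], rule suminf_nonneg[OF gauss_powr_summable]) simp
  have C: "0 \<le> C"
  proof -
    have "0 < Gamma ((l - real DIM('a)) / 2 + 1)" using l by (intro Gamma_real_pos) (simp add: field_simps)
    then show ?thesis using S(2) by (simp add: C_def)
  qed
  show ?thesis
  \<comment> \<open>Each of the two parts contributes \<open>2 * C\<close> times the squared Morrey
    norm, the 2 coming from \<open>norm_diff_sq_le\<close>; the root undoes the square.\<close>
  proof (intro exI[of _ "sqrt (4 * C)"] ballI)
    fix \<mu> assume \<mu>: "\<mu> \<in> morrey_on p \<Omega> \<inter> bounded_radon"
    let ?M = "enn2real (morrey_norm p \<mu>)" and ?T = "distr_of_measure \<mu>"
    let ?w = "\<lambda>f \<xi>::'a. ennreal ((cmod (f \<xi>))\<^sup>2 / (1 + (norm \<xi>)\<^sup>2))"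
    let ?P = "fourier_measure (pos_part \<mu>)" and ?N = "fourier_measure (neg_part \<mu>)"
    have \<mu>': "(\<lambda>A. - \<mu> A) \<in> morrey_on p \<Omega> \<inter> bounded_radon"
      using \<mu> morrey_on_uminus bounded_radon_uminus by blast
    have P: "(\<integral>\<^sup>+\<xi>. ?w ?P \<xi> \<partial>lborel) \<le> ennreal (C * ?M\<^sup>2)"
      using pos_part_sqnorm_bound[OF \<mu> R(2,1)] l S by (simp add: C_def l_def)
    have N: "(\<integral>\<^sup>+\<xi>. ?w ?N \<xi> \<partial>lborel) \<le> ennreal (C * ?M\<^sup>2)"
      using pos_part_sqnorm_bound[OF \<mu>' R(2,1)] l S by (simp add: C_def l_def neg_part_def morrey_norm_uminus)
    have F: "is_function (fourier_distr ?T) (\<lambda>\<xi>. ?P \<xi> - ?N \<xi>)"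
      using \<mu> by (intro fourier_distr_of_measure) simp
    have [measurable]: "?P \<in> borel_measurable borel" "?N \<in> borel_measurable borel"
      using \<mu> by (intro fourier_measure_measurable finite_measure_pos_part finite_measure_neg_part
          sets_pos_part sets_neg_part; simp)+
    \<comment> \<open>\<open>ennreal\<close> sends negative reals to 0, so the sum is split for
      nonnegative summands.\<close>
    have dbl: "ennreal (2 * a + 2 * b) = 2 * ennreal a + 2 * ennreal b" if "0 \<le> a" "0 \<le> b" for a b
      using that by (simp add: ennreal_plus ennreal_mult')
    have "Hm1_sqnorm ?T \<le> (\<integral>\<^sup>+\<xi>. 2 * ?w ?P \<xi> + 2 * ?w ?N \<xi> \<partial>lborel)"
      unfolding Hm1_sqnorm_is_function[OF F]
    proof (rule nn_integral_mono)
      fix \<xi>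
      have "(cmod (?P \<xi> - ?N \<xi>))\<^sup>2 / (1 + (norm \<xi>)\<^sup>2)
          \<le> (2 * (cmod (?P \<xi>))\<^sup>2 + 2 * (cmod (?N \<xi>))\<^sup>2) / (1 + (norm \<xi>)\<^sup>2)"
        by (intro divide_right_mono norm_diff_sq_le) simp
      then have "ennreal ((cmod (?P \<xi> - ?N \<xi>))\<^sup>2 / (1 + (norm \<xi>)\<^sup>2))
          \<le> ennreal (2 * ((cmod (?P \<xi>))\<^sup>2 / (1 + (norm \<xi>)\<^sup>2)) + 2 * ((cmod (?N \<xi>))\<^sup>2 / (1 + (norm \<xi>)\<^sup>2)))"
        by (intro ennreal_leI) (simp add: add_divide_distrib)
      then show "ennreal ((cmod (?P \<xi> - ?N \<xi>))\<^sup>2 / (1 + (norm \<xi>)\<^sup>2)) \<le> 2 * ?w ?P \<xi> + 2 * ?w ?N \<xi>"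
        by (simp only: dbl zero_le_divide_iff zero_le_power2 add_nonneg_nonneg zero_le_one simp_thms)
    qed
    also have "\<dots> = 2 * (\<integral>\<^sup>+\<xi>. ?w ?P \<xi> \<partial>lborel) + 2 * (\<integral>\<^sup>+\<xi>. ?w ?N \<xi> \<partial>lborel)"
      by (simp add: nn_integral_add nn_integral_cmult)
    also have "\<dots> \<le> 2 * ennreal (C * ?M\<^sup>2) + 2 * ennreal (C * ?M\<^sup>2)"
      by (intro add_mono mult_left_mono P N) auto
    also have "\<dots> = ennreal (2 * (C * ?M\<^sup>2) + 2 * (C * ?M\<^sup>2))"
      using C by (simp only: dbl mult_nonneg_nonneg zero_le_power2)
    finally have le: "Hm1_sqnorm ?T \<le> ennreal (4 * C * ?M\<^sup>2)"
      by (simp add: mult.assoc)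
    then have "Hm1_sqnorm ?T < \<infinity>"
      by (rule le_less_trans) simp
    then have "?T \<in> Hm1"
      unfolding Hm1_def using F \<mu> tempered_distribution_of_measure by blast
    moreover have "enn2real (Hm1_sqnorm ?T) \<le> 4 * C * ?M\<^sup>2"
      using C by (intro enn2real_leI le) simp
    then have "Hm1_norm ?T \<le> sqrt (4 * C * ?M\<^sup>2)"
      unfolding Hm1_norm_def by (rule real_sqrt_le_mono)
    then have "Hm1_norm ?T \<le> sqrt (4 * C) * ?M"
      by (simp add: real_sqrt_mult)
    ultimately show "?T \<in> Hm1 \<and> Hm1_norm ?T \<le> sqrt (4 * C) * ?M" ..
  qed
qed

end
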